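(* Let $F\in\mathbb C[x,y,z]$ be an irreducible homogeneous polynomial of degree $d\ge 2$, let $\mathcal C=V(F)\subset\mathbb P^2=\mathbb P^2(\mathbb C)$, let $S=(x_0,y_0,z_0)\in\mathbb C^3\setminus\{0\}$ and $\mathcal S=[x_0:y_0:z_0]$. Then the caustic by reflection $\Sigma_{\mathcal S}(\mathcal C)$ satisfies $$\Sigma_{\mathcal S}(\mathcal C)=\overline{\Phi_{F,S}(\mathcal C)}$$ (Zariski closure). Moreover, $\Phi_{F,S}$ maps a generic $m\in\mathcal C$ to the corresponding point of $\Sigma_{\mathcal S}(\mathcal C)$, i.e. to the point at which the reflected line $\mathcal R_m$ touches the envelope of the reflected lines.
   Context: Rational map $\Phi_{F,S}$. Subscripts of $F$ denote partial derivatives. Let $H_F$ be the Hessian determinant of $F$ (determinant of the $3\times 3$ matrix of second partial derivatives), $N_S(x,y,z):=(xz_0-x_0z)^2+(yz_0-y_0z)^2$, $\Delta_SF:=x_0F_x+y_0F_y+z_0F_z$. The rational map $\Phi_{F,S}:\mathbb P^2\to\mathbb P^2$ is the one induced by $$\tilde\Phi_{F,S}:=-\frac{2H_FN_S}{(d-1)^2}\cdot\mathrm{Id}+\Delta_SF\cdot\begin{pmatrix}F_y^2x_0-F_x^2x_0-2F_xF_yy_0-2F_xF_zz_0\\ F_x^2y_0-F_y^2y_0-2F_xF_yx_0-2F_yF_zz_0\\ z_0(F_x^2+F_y^2)\end{pmatrix}.$$ $\Phi_{F,S}(\mathcal C)$ is the image of the points of $\mathcal C$ at which $\tilde\Phi_{F,S}\neq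 0$. Reflected lines. Let $\ell_\infty=V(z)$ and let $Reg(\mathcal C)$ be the set of points of $\mathcal C$ where $DF\ne0$. For $m=[x:y:z]\in Reg(\mathcal C)\setminus(\{\mathcal S\}\cup\ell_\infty)$, the reflected line $\mathcal R_m$ (the line through $m$ obtained from the incident line $(\mathcal Sm)$ by the reflection law with respect to the tangent line of $\mathcal C$ at $m$) is the line of equation $\langle\tilde\rho(x,y,z),(X,Y,Z)\rangle=0$, where $\langle\cdot,\cdot\rangle$ is the standard bilinear form on $\mathbb C^3$ and $$\tilde\rho=\begin{pmatrix}z(z_0y-zy_0)(F_x^2-F_y^2)+2z(zx_0-z_0x)F_xF_y\\ z(z_0x-zx_0)(F_x^2-F_y^2)+2z(z_0y-zy_0)F_xF_y\\ (xzy_0+yzx_0-2z_0xy)(F_x^2-F_y^2)+2(yzy_0-xzx_0+z_0x^2-z_0y^2)F_xF_y\end{pmatrix}\ \text{if }z_0\ne0,$$ $$\tilde\rho=\begin{pmatrix}-zy_0(F_x^2-F_y^2)+2zx_0F_xF_y\\ -zx_0(F_x^2-F_y^2)-2zy_0F_xF_y\\ (xy_0+yx_0)(F_x^2-F_y^2)+2(yy_0-xx_0)F_xF_y\end{pmatrix}\ \text{if }z_0=0$$ (it is defined whenever $\tilde\rho(x,y,z)\neq0$). Caustic. $\Sigma_{\mathcal S}(\mathcal C)$ is the Zariski closure of the envelope of the lines $\mathcal R_m$, $m\in Reg(\mathcal C)\setminus(\{\mathcal S\}\cup\ell_\infty)$. Here the point of contact of $\mathcal R_m$ with the envelope is the point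 $[X:Y:Z]$ determined by $\langle r(0),(X,Y,Z)\rangle=0$ and $\langle r'(0),(X,Y,Z)\rangle=0$, where $t\mapsto [x(t):y(t):1]$ is a regular local parametrization of $\mathcal C$ at $m$ (with value $m$ at $t=0$) and $r(t)=\tilde\rho(x(t),y(t),1)$; it is defined when $r(0)$ and $r'(0)$ are linearly independent, and the envelope is the set of these points of contact. *)

theory Defs
  imports "HOL-Complex_Analysis.Complex_Analysis" "HOL-Computational_Algebra.Computational_Algebra"
begin

section \<open>The complex projective plane\<close>

definition proj_rel :: "complex^3 \<Rightarrow> complex^3 \<Rightarrow> bool" where
  "proj_rel u v \<longleftrightarrow> u \<noteq> 0 \<and> v \<noteq> 0 \<and> (\<exists>c. v = c *s u)"

lemma part_equivp_proj_rel: "part_equivp proj_rel"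
proof (rule part_equivpI)
  show "\<exists>x. proj_rel x x"
    by (rule exI[of _ "axis 1 1"]) (auto simp: proj_rel_def axis_eq_0_iff intro: exI[of _ 1])
  show "symp proj_rel"
  proof (rule sympI)
    fix u v assume uv: "proj_rel u v"
    then obtain c where c: "v = c *s u" by (auto simp: proj_rel_def)
    with uv have "c \<noteq> 0" by (auto simp: proj_rel_def)
    hence "u = inverse c *s v" by (simp add: c vector_smult_assoc)
    with uv show "proj_rel v u" by (auto simp: proj_rel_def)
  qed
  show "transp proj_rel"
    by (rule transpI) (auto simp: proj_rel_def vector_smult_assoc)
qed

quotient_type cp2 = "complex^3" / partial: proj_rel
  by (rule part_equivp_proj_rel)

text \<open>\<open>proj v\<close> is meaningful only for \<open>v \<noteq> 0\<close>; \<open>rep_cp2 p\<close> is some (nonzero) vector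
  of homogeneous coordinates of \<open>p\<close>.\<close>

abbreviation proj :: "complex^3 \<Rightarrow> cp2" where
  "proj \<equiv> abs_cp2"

lemma rep_cp2_nonzero: "rep_cp2 p \<noteq> 0"
  using Quotient3_rep_reflp[OF Quotient3_cp2, of p] by (auto simp: proj_rel_def)

lemma proj_rep_cp2: "proj (rep_cp2 p) = p"
  by (rule Quotient3_abs_rep[OF Quotient3_cp2])

lemma proj_eq_iff:
  assumes "u \<noteq> 0" "v \<noteq> 0"
  shows "proj u = proj v \<longleftrightarrow> (\<exists>c. v = c *s u)"
proof -
  have refl: "proj_rel w w" if "w \<noteq> 0" for w
    using that by (auto simp: proj_rel_def intro: exI[of _ 1])
  show ?thesis
    using Quotient3_rel[OF Quotient3_cp2, of u v] refl assms by (auto simp: proj_rel_def)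
qed

section \<open>Polynomials in three variables\<close>

text \<open>\<open>\<complex>[x,y,z]\<close> is represented as \<open>\<complex>[z][y][x]\<close>: the coefficient of \<open>x\<^sup>i y\<^sup>j z\<^sup>k\<close> in \<open>F\<close>
  is \<open>coeff (coeff (coeff F i) j) k\<close>.\<close>

type_synonym poly3 = "complex poly poly poly"

definition eval3 :: "poly3 \<Rightarrow> complex^3 \<Rightarrow> complex" where
  "eval3 F v = poly (poly (poly F [:[:v$1:]:]) [:v$2:]) (v$3)"

definition homogeneous :: "nat \<Rightarrow> poly3 \<Rightarrow> bool" where
  "homogeneous d F \<longleftrightarrow> (\<forall>i j k. coeff (coeff (coeff F i) j) k \<noteq> 0 \<longrightarrow> i + j + k = d)"

definition pdiff :: "3 \<Rightarrow> poly3 \<Rightarrow> poly3" where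
  "pdiff n F = (if n = 1 then pderiv F
                else if n = 2 then map_poly pderiv F
                else map_poly (map_poly pderiv) F)"

definition gradient :: "poly3 \<Rightarrow> complex^3 \<Rightarrow> complex^3" where
  "gradient F v = (\<chi> n. eval3 (pdiff n F) v)"

definition hessian :: "poly3 \<Rightarrow> complex^3 \<Rightarrow> complex" where
  "hessian F v = det (\<chi> m n. eval3 (pdiff m (pdiff n F)) v)"

text \<open>The standard bilinear (not Hermitian) form.\<close>

definition bilin :: "complex^3 \<Rightarrow> complex^3 \<Rightarrow> complex" where
  "bilin u v = (\<Sum>n\<in>UNIV. u$n * v$n)"

definition zero_locus :: "poly3 set \<Rightarrow> cp2 set" where
  "zero_locus T = {p. \<forall>G\<in>T. \<forall>v. v \<noteq> 0 \<and> proj v = p \<longrightarrow> eval3 G v = 0}"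

abbreviation curve :: "poly3 \<Rightarrow> cp2 set" where
  "curve F \<equiv> zero_locus {F}"

definition zariski_closed :: "cp2 set \<Rightarrow> bool" where
  "zariski_closed Z \<longleftrightarrow> (\<exists>T. (\<forall>G\<in>T. \<exists>n. homogeneous n G) \<and> Z = zero_locus T)"

definition zariski_closure :: "cp2 set \<Rightarrow> cp2 set" where
  "zariski_closure A = zariski_closed hull A"

text \<open>\<open>P\<close> holds on a nonempty relatively open subset of \<open>C\<close>, which is dense
  when \<open>C\<close> is irreducible.\<close>

definition for_generic :: "cp2 set \<Rightarrow> (cp2 \<Rightarrow> bool) \<Rightarrow> bool" where
  "for_generic C P \<longleftrightarrow> (\<exists>Z. zariski_closed Z \<and> \<not> C \<subseteq> Z \<and> (\<forall>m\<in>C - Z. P m))"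

section \<open>The rational map\<close>

definition N_poly :: "complex^3 \<Rightarrow> complex^3 \<Rightarrow> complex" where
  "N_poly S v = (v$1 * S$3 - S$1 * v$3)^2 + (v$2 * S$3 - S$2 * v$3)^2"

definition Delta :: "poly3 \<Rightarrow> complex^3 \<Rightarrow> complex^3 \<Rightarrow> complex" where
  "Delta F S v = bilin S (gradient F v)"

definition Phi_tilde :: "nat \<Rightarrow> poly3 \<Rightarrow> complex^3 \<Rightarrow> complex^3 \<Rightarrow> complex^3" where
  "Phi_tilde d F S v =
    (let x0 = S$1; y0 = S$2; z0 = S$3;
         Fx = gradient F v $ 1; Fy = gradient F v $ 2; Fz = gradient F v $ 3
     in (- (2 * hessian F v * N_poly S v / (of_nat d - 1)^2)) *s v +
        Delta F S v *s
          vector [Fy^2 * x0 - Fx^2 * x0 - 2 * Fx * Fy * y0 - 2 * Fx * Fz * z0,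
                  Fx^2 * y0 - Fy^2 * y0 - 2 * Fx * Fy * x0 - 2 * Fy * Fz * z0,
                  z0 * (Fx^2 + Fy^2)])"

text \<open>For \<open>F\<close> homogeneous of degree \<open>d\<close>, \<open>Phi_tilde\<close> is homogeneous of degree \<open>3 (d - 1)\<close>, so
  neither definition depends on the representative: see \<open>Phi_defined_proj\<close> and \<open>Phi_proj\<close>.\<close>

definition Phi_defined :: "nat \<Rightarrow> poly3 \<Rightarrow> complex^3 \<Rightarrow> cp2 \<Rightarrow> bool" where
  "Phi_defined d F S m \<longleftrightarrow> Phi_tilde d F S (rep_cp2 m) \<noteq> 0"

definition Phi :: "nat \<Rightarrow> poly3 \<Rightarrow> complex^3 \<Rightarrow> cp2 \<Rightarrow> cp2" where
  "Phi d F S m = proj (Phi_tilde d F S (rep_cp2 m))"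

definition Phi_image :: "nat \<Rightarrow> poly3 \<Rightarrow> complex^3 \<Rightarrow> cp2 set \<Rightarrow> cp2 set" where
  "Phi_image d F S C = Phi d F S ` {m \<in> C. Phi_defined d F S m}"

section \<open>Reflected lines and the caustic\<close>

definition rho_tilde :: "poly3 \<Rightarrow> complex^3 \<Rightarrow> complex^3 \<Rightarrow> complex^3" where
  "rho_tilde F S v =
    (let x = v$1; y = v$2; z = v$3; x0 = S$1; y0 = S$2; z0 = S$3;
         Fx = gradient F v $ 1; Fy = gradient F v $ 2
     in if z0 \<noteq> 0 then
          vector [z * (z0 * y - z * y0) * (Fx^2 - Fy^2) + 2 * z * (z * x0 - z0 * x) * Fx * Fy,
                  z * (z0 * x - z * x0) * (Fx^2 - Fy^2) + 2 * z * (z0 * y - z * y0) * Fx * Fy,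
                  (x * z * y0 + y * z * x0 - 2 * z0 * x * y) * (Fx^2 - Fy^2)
                    + 2 * (y * z * y0 - x * z * x0 + z0 * x^2 - z0 * y^2) * Fx * Fy]
        else
          vector [- z * y0 * (Fx^2 - Fy^2) + 2 * z * x0 * Fx * Fy,
                  - z * x0 * (Fx^2 - Fy^2) - 2 * z * y0 * Fx * Fy,
                  (x * y0 + y * x0) * (Fx^2 - Fy^2) + 2 * (y * y0 - x * x0) * Fx * Fy])"

definition proj_line :: "complex^3 \<Rightarrow> cp2 set" where
  "proj_line w = {proj u | u. u \<noteq> 0 \<and> bilin w u = 0}"

text \<open>The reflected line at the point with homogeneous coordinates \<open>v\<close>;
  a line only if \<open>rho_tilde F S v \<noteq> 0\<close>.\<close>

definition reflected_line :: "poly3 \<Rightarrow> complex^3 \<Rightarrow> complex^3 \<Rightarrow> cp2 set" where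
  "reflected_line F S v = proj_line (rho_tilde F S v)"

definition line_at_infinity :: "cp2 set" where
  "line_at_infinity = proj_line (vector [0, 0, 1])"

definition Reg :: "poly3 \<Rightarrow> cp2 set" where
  "Reg F = {proj v | v. v \<noteq> 0 \<and> proj v \<in> curve F \<and> gradient F v \<noteq> 0}"

definition regular_local_param ::
    "poly3 \<Rightarrow> cp2 \<Rightarrow> (complex \<Rightarrow> complex) \<Rightarrow> (complex \<Rightarrow> complex) \<Rightarrow> bool" where
  "regular_local_param F m x y \<longleftrightarrow>
     proj (vector [x 0, y 0, 1]) = m \<and>
     (\<exists>e>0. x holomorphic_on ball 0 e \<and> y holomorphic_on ball 0 e \<and>
            (\<forall>t\<in>ball 0 e. proj (vector [x t, y t, 1]) \<in> curve F)) \<and>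
     (deriv x 0 \<noteq> 0 \<or> deriv y 0 \<noteq> 0)"

definition lin_indep2 :: "complex^3 \<Rightarrow> complex^3 \<Rightarrow> bool" where
  "lin_indep2 u v \<longleftrightarrow> (\<forall>a b. a *s u + b *s v = 0 \<longrightarrow> a = 0 \<and> b = 0)"

text \<open>\<open>p\<close> is the point at which the reflected line at \<open>m\<close> touches the envelope: it lies on the
  line with coefficients \<open>r 0\<close>, which is the reflected line at \<open>m\<close>, and on the line with
  coefficients \<open>r' 0\<close>.\<close>

definition contact_point :: "poly3 \<Rightarrow> complex^3 \<Rightarrow> cp2 \<Rightarrow> cp2 \<Rightarrow> bool" where
  "contact_point F S m p \<longleftrightarrow>
    (\<exists>x y. regular_local_param F m x y \<and>
       (let r = (\<lambda>t. rho_tilde F S (vector [x t, y t, 1]));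
            r' = (\<chi> n. deriv (\<lambda>t. r t $ n) 0)
        in lin_indep2 (r 0) r' \<and>
           p \<in> reflected_line F S (vector [x 0, y 0, 1]) \<and> p \<in> proj_line r'))"

definition admissible_points :: "poly3 \<Rightarrow> complex^3 \<Rightarrow> cp2 set" where
  "admissible_points F S = Reg F - ({proj S} \<union> line_at_infinity)"

definition envelope :: "poly3 \<Rightarrow> complex^3 \<Rightarrow> cp2 set" where
  "envelope F S = {p. \<exists>m\<in>admissible_points F S. contact_point F S m p}"

definition caustic :: "poly3 \<Rightarrow> complex^3 \<Rightarrow> cp2 set" where
  "caustic F S = zariski_closure (envelope F S)"

section \<open>Independence of the representative\<close>

lemma poly_eq_sum_large:
  fixes p :: "'a :: comm_semiring_1 poly"
  assumes "degree p \<le> N"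
  shows "poly p a = (\<Sum>i\<le>N. coeff p i * a ^ i)"
  unfolding poly_altdef
  by (rule sum.mono_neutral_left) (use assms in \<open>auto simp: coeff_eq_0\<close>)

lemma homogeneous_coeff_eq_0:
  assumes "homogeneous d F" "i > d"
  shows "coeff F i = 0"
proof (intro poly_eqI)
  fix j k
  show "coeff (coeff (coeff F i) j) k = coeff (coeff 0 j) k"
    using assms unfolding homogeneous_def by (metis coeff_0 not_add_less1 add.assoc)
qed

lemma eval3_altdef:
  assumes "homogeneous d F"
  shows "eval3 F v = (\<Sum>i\<le>d. \<Sum>j\<le>d. \<Sum>k\<le>d.
           coeff (coeff (coeff F i) j) k * v$1 ^ i * v$2 ^ j * v$3 ^ k)"
proof -
  have 1: "degree F \<le> d"
    using homogeneous_coeff_eq_0[OF assms] by (intro degree_le) auto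
  have 2: "degree (coeff F i) \<le> d" for i
    by (rule degree_le) (use assms in \<open>fastforce simp: homogeneous_def intro!: poly_eqI\<close>)
  have 3: "degree (coeff (coeff F i) j) \<le> d" for i j
    by (rule degree_le) (use assms in \<open>fastforce simp: homogeneous_def\<close>)
  have c1: "[:[:a:]:] ^ i = [:[:a ^ i:]:]" and c2: "[:a:] ^ i = [:a ^ i:]" for a :: complex and i
    by (induction i) (auto simp: one_pCons)
  show ?thesis
    unfolding eval3_def
    by (simp add: poly_eq_sum_large[OF 1] poly_sum poly_eq_sum_large[OF 2]
          poly_eq_sum_large[OF 3] c1 c2 sum_distrib_right sum_distrib_left mult_ac)
qed

lemma eval3_scale:
  assumes "homogeneous d F"
  shows "eval3 F (c *s v) = c ^ d * eval3 F v"
proof -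
  have "coeff (coeff (coeff F i) j) k * (c * v$1) ^ i * (c * v$2) ^ j * (c * v$3) ^ k =
        c ^ d * (coeff (coeff (coeff F i) j) k * v$1 ^ i * v$2 ^ j * v$3 ^ k)" for i j k
  proof (cases "i + j + k = d")
    case True
    then show ?thesis by (auto simp: power_mult_distrib power_add)
  next
    case False
    with assms have "coeff (coeff (coeff F i) j) k = 0" by (auto simp: homogeneous_def)
    then show ?thesis by simp
  qed
  then show ?thesis
    by (simp only: eval3_altdef[OF assms] sum_distrib_left vector_smult_component)
qed

lemma homogeneous_pdiff:
  assumes "homogeneous d F"
  shows "homogeneous (d - 1) (pdiff n F)"
proof -
  have of_nat_coeff: "coeff (of_nat n * p) k = of_nat n * coeff p k"
    for n k and p :: "complex poly"
    by (simp add: of_nat_poly)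
  have of_nat_coeff': "coeff (of_nat n * p) k = of_nat n * coeff p k"
    for n k and p :: "complex poly poly"
    by (simp add: of_nat_poly)
  have *: "i + j + k = d" if "coeff (coeff (coeff F i) j) k \<noteq> 0" for i j k
    using assms that by (auto simp: homogeneous_def)
  consider "n = 1" | "n = 2" | "n \<noteq> 1" "n \<noteq> 2" by blast
  then show ?thesis
  proof cases
    case 1
    then show ?thesis
      unfolding homogeneous_def pdiff_def
      by (auto simp: coeff_pderiv of_nat_coeff of_nat_coeff' simp del: of_nat_Suc dest!: *)
  next
    case 2
    then show ?thesis
      unfolding homogeneous_def pdiff_def
      by (auto simp: coeff_pderiv coeff_map_poly of_nat_coeff simp del: of_nat_Suc dest!: *)
  next
    case 3
    then show ?thesis
      unfolding homogeneous_def pdiff_def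
      by (auto simp: coeff_pderiv coeff_map_poly simp del: of_nat_Suc dest!: *)
  qed
qed

lemma Phi_tilde_scale:
  assumes "homogeneous d F" "d \<ge> 2"
  shows "Phi_tilde d F S (c *s v) = c ^ (3 * (d - 1)) *s Phi_tilde d F S v"
proof -
  obtain e where d: "d = Suc (Suc e)"
    using assms(2) by (metis add_2_eq_Suc le_Suc_ex)
  have g: "gradient F (c *s v) = c ^ Suc e *s gradient F v"
    using eval3_scale[OF homogeneous_pdiff[OF assms(1)]]
    by (simp add: gradient_def vec_eq_iff d)
  have "eval3 (pdiff m (pdiff n F)) (c *s v) = c ^ e * eval3 (pdiff m (pdiff n F)) v" for m n
    using eval3_scale[OF homogeneous_pdiff[OF homogeneous_pdiff[OF assms(1)]]] by (simp add: d)
  then have h: "hessian F (c *s v) = (c ^ e) ^ 3 * hessian F v"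
    by (simp add: hessian_def det_3 algebra_simps power3_eq_cube)
  have n: "N_poly S (c *s v) = c ^ 2 * N_poly S v"
    by (simp add: N_poly_def algebra_simps power2_eq_square)
  have D: "Delta F S (c *s v) = c ^ Suc e * Delta F S v"
    by (simp add: Delta_def g bilin_def sum_distrib_left mult_ac)
  have c: "c ^ (3 * (d - 1)) = (c ^ e) ^ 3 * c ^ 3"
    by (simp add: d power_add power_mult[symmetric] mult.commute flip: power_Suc)
  show ?thesis
    unfolding Phi_tilde_def Let_def g h n D c
    by (simp add: vec_eq_iff forall_3 vector_3 field_simps power2_eq_square power3_eq_cube)
qed

lemma
  assumes "homogeneous d F" "d \<ge> 2" "v \<noteq> 0"
  shows Phi_defined_proj: "Phi_defined d F S (proj v) \<longleftrightarrow> Phi_tilde d F S v \<noteq> 0"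
    and Phi_proj: "Phi_tilde d F S v \<noteq> 0 \<Longrightarrow> Phi d F S (proj v) = proj (Phi_tilde d F S v)"
proof -
  obtain c where c: "rep_cp2 (proj v) = c *s v"
    using proj_eq_iff[OF assms(3) rep_cp2_nonzero] by (metis proj_rep_cp2)
  then have "c \<noteq> 0"
    using rep_cp2_nonzero by (metis vector_smult_lzero)
  then show "Phi_defined d F S (proj v) \<longleftrightarrow> Phi_tilde d F S v \<noteq> 0"
    by (simp add: Phi_defined_def c Phi_tilde_scale[OF assms(1,2)])
  assume nz: "Phi_tilde d F S v \<noteq> 0"
  with \<open>c \<noteq> 0\<close> have "proj (Phi_tilde d F S v) = proj (Phi_tilde d F S (c *s v))"
    by (subst proj_eq_iff) (auto simp: Phi_tilde_scale[OF assms(1,2)])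
  then show "Phi d F S (proj v) = proj (Phi_tilde d F S v)"
    by (simp add: Phi_def c)
qed

end

theory Submission
  imports Defs "HOL-Computational_Algebra.Field_as_Ring"
begin

text \<open>
  Along a local parametrization \<open>(x(t), y(t), 1)\<close> at \<open>m\<close> with tangent vector
  \<open>\<tau> (F\<^sub>y, -F\<^sub>x, 0)\<close>, the Euler relations turn the point of contact
  \<open>r \<times> r'\<close> of the reflected line with coordinates \<open>r\<close> into
  \<open>-\<tau> (F\<^sub>x\<^sup>2 + F\<^sub>y\<^sup>2) \<Phi>\<close>, a polynomial identity modulo \<open>F\<close>. So every contact point is
  the image of its point of incidence under \<open>\<Phi>\<close>. Conversely
  \<open>\<langle>DF, \<Phi>\<rangle> = -(\<Delta>\<^sub>S F)\<^sup>2 (F\<^sub>x\<^sup>2 + F\<^sub>y\<^sup>2)\<close> on the curve, so \<open>\<Phi>\<close> is defined and is the contact point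
  wherever \<open>K = z \<Delta>\<^sub>S F (F\<^sub>x\<^sup>2 + F\<^sub>y\<^sup>2)\<close> does not vanish. Since an irreducible \<open>F\<close> of degree at least
  two is not a cone, \<open>F\<close> does not divide \<open>K\<close>. If a form \<open>G\<close> vanishes on the envelope, then
  \<open>(G \<circ> \<Phi>) K\<close> vanishes on the curve, so \<open>F\<close> divides \<open>G \<circ> \<Phi>\<close> by the Nullstellensatz for the
  prime element \<open>F\<close>, and \<open>G\<close> vanishes on the whole image of \<open>\<Phi>\<close>.
\<close>

no_notation fps_nth (infixl "$" 75)

section \<open>Evaluation and homogeneity under the ring operations\<close>

lemma eval3_add [simp]: "eval3 (F + G) v = eval3 F v + eval3 G v"
  and eval3_diff [simp]: "eval3 (F - G) v = eval3 F v - eval3 G v"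
  and eval3_uminus [simp]: "eval3 (- F) v = - eval3 F v"
  and eval3_mult [simp]: "eval3 (F * G) v = eval3 F v * eval3 G v"
  and eval3_0 [simp]: "eval3 0 v = 0"
  and eval3_const [simp]: "eval3 [:[:[:c:]:]:] v = c"
  by (simp_all add: eval3_def)

lemma homogeneous_z: "homogeneous 1 [:[:[:0, 1:]:]:]"
  by (auto simp: homogeneous_def coeff_pCons one_pCons split: nat.splits if_splits)

lemma homogeneous_add:
  "homogeneous n F \<Longrightarrow> homogeneous n G \<Longrightarrow> homogeneous n (F + G)"
  by (simp add: homogeneous_def) (metis add_cancel_left_left)

lemma homogeneous_mult:
  assumes "homogeneous m F" "homogeneous n G"
  shows "homogeneous (m + n) (F * G)"
  unfolding homogeneous_def
proof (intro allI impI)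
  fix i j k
  assume "coeff (coeff (coeff (F * G) i) j) k \<noteq> 0"
  then have "(\<Sum>a\<le>i. \<Sum>b\<le>j. \<Sum>c\<le>k. coeff (coeff (coeff F a) b) c *
               coeff (coeff (coeff G (i - a)) (j - b)) (k - c)) \<noteq> 0"
    by (simp add: coeff_mult coeff_sum)
  then obtain a b c where "a \<le> i" "b \<le> j" "c \<le> k" "coeff (coeff (coeff F a) b) c \<noteq> 0"
      "coeff (coeff (coeff G (i - a)) (j - b)) (k - c) \<noteq> 0"
    by (elim sum.not_neutral_contains_not_neutral) auto
  moreover from this have "a + b + c = m" "(i - a) + (j - b) + (k - c) = n"
    using assms unfolding homogeneous_def by blast+
  ultimately show "i + j + k = m + n" by linarith
qed

lemma homogeneous_const: "homogeneous 0 [:[:[:c:]:]:]"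
  by (auto simp: homogeneous_def coeff_pCons split: nat.splits if_splits)

lemma homogeneous_const_mult: "homogeneous n F \<Longrightarrow> homogeneous n ([:[:[:c:]:]:] * F)"
  using homogeneous_mult[OF homogeneous_const] by fastforce

subsection \<open>Polynomial functions\<close>

text \<open>Closure properties of this predicate yield a polynomial representing \<open>G\<close>
  composed with \<open>Phi_tilde\<close> without writing it out.\<close>

definition poly_fun3 :: "(complex^3 \<Rightarrow> complex) \<Rightarrow> bool" where
  "poly_fun3 f \<longleftrightarrow> (\<exists>G. \<forall>v. f v = eval3 G v)"

lemma poly_fun3_eval3: "poly_fun3 (eval3 G)"
  by (auto simp: poly_fun3_def)

lemma poly_fun3_const: "poly_fun3 (\<lambda>v. c)"
  unfolding poly_fun3_def by (rule exI[of _ "[:[:[:c:]:]:]"]) simp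

lemma poly_fun3_add: "poly_fun3 f \<Longrightarrow> poly_fun3 g \<Longrightarrow> poly_fun3 (\<lambda>v. f v + g v)"
  unfolding poly_fun3_def by (metis eval3_add)

lemma poly_fun3_diff: "poly_fun3 f \<Longrightarrow> poly_fun3 g \<Longrightarrow> poly_fun3 (\<lambda>v. f v - g v)"
  unfolding poly_fun3_def by (metis eval3_diff)

lemma poly_fun3_uminus: "poly_fun3 f \<Longrightarrow> poly_fun3 (\<lambda>v. - f v)"
  unfolding poly_fun3_def by (metis eval3_uminus)

lemma poly_fun3_mult: "poly_fun3 f \<Longrightarrow> poly_fun3 g \<Longrightarrow> poly_fun3 (\<lambda>v. f v * g v)"
  unfolding poly_fun3_def by (metis eval3_mult)

lemma poly_fun3_power: "poly_fun3 f \<Longrightarrow> poly_fun3 (\<lambda>v. f v ^ n)"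
  by (induction n) (auto intro: poly_fun3_const poly_fun3_mult)

lemma poly_fun3_sum: "(\<And>i. i \<in> A \<Longrightarrow> poly_fun3 (f i)) \<Longrightarrow> poly_fun3 (\<lambda>v. \<Sum>i\<in>A. f i v)"
  by (induction A rule: infinite_finite_induct) (auto intro: poly_fun3_const poly_fun3_add)

lemma poly_fun3_nth: "poly_fun3 (\<lambda>v. v $ n)"
proof -
  have "poly_fun3 (\<lambda>v. v $ 1)" "poly_fun3 (\<lambda>v. v $ 2)" "poly_fun3 (\<lambda>v. v $ 3)"
    unfolding poly_fun3_def
    by (rule exI[of _ "[:0, 1:]"] exI[of _ "[:[:0, 1:]:]"] exI[of _ "[:[:[:0, 1:]:]:]"];
        simp add: eval3_def)+
  then show ?thesis using exhaust_3[of n] by auto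
qed

lemmas poly_fun3_intros = poly_fun3_eval3 poly_fun3_const poly_fun3_add poly_fun3_diff
  poly_fun3_uminus poly_fun3_mult poly_fun3_power poly_fun3_sum poly_fun3_nth

text \<open>Homogeneity provides the expansion of \<open>G\<close> into finitely many monomials,
  each of which is polynomial after substitution.\<close>

lemma poly_fun3_compose:
  fixes f :: "complex^3 \<Rightarrow> complex^3"
  assumes "homogeneous n G" "\<And>i. poly_fun3 (\<lambda>v. f v $ i)"
  shows "poly_fun3 (\<lambda>v. eval3 G (f v))"
  unfolding eval3_altdef[OF assms(1)] by (intro poly_fun3_intros assms(2))

lemma poly_fun3_gradient: "poly_fun3 (\<lambda>v. gradient F v $ n)"
  by (simp add: gradient_def poly_fun3_eval3)

lemma poly_fun3_Phi_tilde: "poly_fun3 (\<lambda>v. Phi_tilde d F S v $ n)"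
proof -
  have D: "poly_fun3 (\<lambda>v. Delta F S v)"
    unfolding Delta_def bilin_def by (intro poly_fun3_intros poly_fun3_gradient)
  have H: "poly_fun3 (\<lambda>v. hessian F v)"
    unfolding hessian_def det_3 by (simp, intro poly_fun3_intros)
  have N: "poly_fun3 (\<lambda>v. N_poly S v)"
    unfolding N_poly_def by (intro poly_fun3_intros)
  show ?thesis
    using exhaust_3[of n]
    by (elim disjE; simp add: Phi_tilde_def Let_def divide_inverse;
        intro poly_fun3_intros D H N poly_fun3_gradient)
qed

subsection \<open>Points where polynomials do not vanish\<close>

lemma finite_const_roots:
  fixes p :: "'a::idom poly poly"
  assumes "p \<noteq> 0"
  shows "finite {a. poly p [:a:] = 0}"
proof -
  have "finite ((\<lambda>a. [:a:]) -` {b. poly p b = 0})"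
    by (rule finite_vimageI) (auto simp: poly_roots_finite assms inj_on_def)
  then show ?thesis by (simp add: vimage_def)
qed

text \<open>The coefficients of a \<open>poly3\<close> with respect to x are polynomials in y and z;
  leading coefficients are evaluated this way.\<close>

definition eval2 :: "complex poly poly \<Rightarrow> complex \<Rightarrow> complex \<Rightarrow> complex" where
  "eval2 f y z = poly (poly f [:y:]) z"

lemma eval2_simps [simp]:
  "eval2 0 y z = 0" "eval2 (f + g) y z = eval2 f y z + eval2 g y z"
  "eval2 (f * g) y z = eval2 f y z * eval2 g y z"
  by (simp_all add: eval2_def)

lemma eval2_pCons: "eval2 (pCons p f) y z = poly p z + y * eval2 f y z"
  by (simp add: eval2_def)

lemma eval2_nonzero_point:
  assumes "f \<noteq> 0"
  obtains y z where "eval2 f y z \<noteq> 0"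
proof -
  obtain y where "poly f [:y:] \<noteq> 0"
    using ex_new_if_finite[OF infinite_UNIV_char_0 finite_const_roots[OF assms]] by auto
  then obtain z where "poly (poly f [:y:]) z \<noteq> 0"
    using poly_all_0_iff_0 by blast
  then show ?thesis using that by (auto simp: eval2_def)
qed

lemma eval3_nonzero_point:
  assumes "G \<noteq> 0"
  obtains v where "eval3 G v \<noteq> 0"
proof -
  have "finite ((\<lambda>a. [:a:]) -` {b. poly G [:b:] = 0})"
    by (rule finite_vimageI) (auto simp: finite_const_roots assms inj_on_def)
  then obtain x where "poly G [:[:x:]:] \<noteq> 0"
    using ex_new_if_finite[OF infinite_UNIV_char_0] by (auto simp: vimage_def)
  then obtain y z where "eval2 (poly G [:[:x:]:]) y z \<noteq> 0"
    by (rule eval2_nonzero_point)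
  then show ?thesis using that[of "vector [x, y, z]"] by (simp add: eval3_def eval2_def)
qed

definition slice :: "poly3 \<Rightarrow> complex \<Rightarrow> complex \<Rightarrow> complex poly" where
  "slice G y z = map_poly (\<lambda>f. eval2 f y z) G"

lemma poly_slice: "poly (slice G y z) x = eval3 G (vector [x, y, z])"
  unfolding slice_def
  by (induction G) (auto simp: map_poly_pCons eval3_def eval2_def)

lemma degree_slice:
  assumes "eval2 (lead_coeff G) y z \<noteq> 0"
  shows "degree (slice G y z) = degree G"
proof (rule antisym)
  show "degree (slice G y z) \<le> degree G"
    by (rule degree_le) (simp add: slice_def coeff_map_poly coeff_eq_0)
  show "degree G \<le> degree (slice G y z)"
    by (rule le_degree) (simp add: slice_def coeff_map_poly assms)
qed

text \<open>Where the leading coefficient does not vanish, fixing y and z preserves the degree in x,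
  and the fundamental theorem of algebra supplies a root.\<close>

lemma eval3_root_over:
  assumes "degree F > 0" "eval2 (lead_coeff F) y z \<noteq> 0"
  obtains x where "eval3 F (vector [x, y, z]) = 0"
  using fundamental_theorem_of_algebra[of "slice F y z"] degree_slice[OF assms(2)] assms(1)
  by (auto simp: constant_degree poly_slice)

subsection \<open>The Nullstellensatz for a hypersurface\<close>

text \<open>A combination of \<open>F\<close> and \<open>G\<close> of minimal degree divides both up to constants, by
  pseudo-division.\<close>

lemma prime_elem_bezout_const:
  fixes F G :: "'a::idom poly"
  assumes F: "prime_elem F" "degree F > 0" and "\<not> F dvd G"
  obtains A B c where "c \<noteq> 0" "A * F + B * G = [:c:]"
proof -
  define I where "I = {A * F + B * G | A B. True}"
  define H where "H = arg_min degree (\<lambda>H. H \<in> I \<and> H \<noteq> 0)"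
  have FI: "F \<in> I" "F \<noteq> 0"
    unfolding I_def using F(2) by (auto intro: exI[of _ 1] exI[of _ 0])
  have H: "H \<in> I" "H \<noteq> 0" and min: "\<And>K. K \<in> I \<Longrightarrow> K \<noteq> 0 \<Longrightarrow> degree H \<le> degree K"
    using arg_min_nat_lemma[of "\<lambda>H. H \<in> I \<and> H \<noteq> 0" F degree] FI by (auto simp: H_def)
  have GI: "G \<in> I"
    unfolding I_def by (auto intro: exI[of _ 1] exI[of _ 0])
  have div: "\<exists>a q. a \<noteq> 0 \<and> smult a K = H * q" if K_I: "K \<in> I" for K
  proof -
    obtain a q where aq: "a \<noteq> 0" "smult a K = H * q + pseudo_mod K H"
      using pseudo_mod(1)[OF H(2), of K] by blast
    obtain A B where K: "K = A * F + B * G" using K_I unfolding I_def by blast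
    obtain C D where H': "H = C * F + D * G" using H unfolding I_def by blast
    have "pseudo_mod K H = smult a K - H * q" using aq by simp
    also have "\<dots> = (smult a A - C * q) * F + (smult a B - D * q) * G"
      unfolding K H' by (simp add: algebra_simps smult_add_right)
    finally have "pseudo_mod K H \<in> I" by (auto simp: I_def)
    then have "pseudo_mod K H = 0"
      using min[of "pseudo_mod K H"] pseudo_mod(2)[OF H(2), of K] by force
    with aq show ?thesis by auto
  qed
  have not_dvd_const: "\<not> F dvd [:a:]" if "a \<noteq> 0" for a
    using dvd_imp_degree_le[of F "[:a:]"] that F(2) by auto
  have "\<not> F dvd H"
  proof
    assume "F dvd H"
    obtain a q where "a \<noteq> 0" "smult a G = H * q" using div[OF GI] by auto
    with \<open>F dvd H\<close> have "F dvd [:a:] * G" by simp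
    from prime_elem_dvd_multD[OF F(1) this] not_dvd_const[OF \<open>a \<noteq> 0\<close>] \<open>\<not> F dvd G\<close>
    show False by blast
  qed
  moreover obtain a q where aq: "a \<noteq> 0" "smult a F = H * q" using div[OF FI(1)] by auto
  then have "F dvd H * q" by (metis dvd_refl dvd_smult)
  ultimately have "F dvd q" using F(1) by (auto dest: prime_elem_dvd_multD)
  \<comment> \<open>Cancelling \<open>F\<close> in a F = H F h leaves H h = a, which puts a nonzero
    constant into the ideal \<open>I\<close>.\<close>
  then obtain h where "q = F * h" by (auto elim: dvdE)
  with aq have "F * [:a:] = F * (H * h)" by (simp add: algebra_simps)
  then have "H * h = [:a:]" by (metis FI(2) mult_left_cancel)
  moreover obtain A B where "H = A * F + B * G" using H unfolding I_def by blast
  ultimately have "(h * A) * F + (h * B) * G = [:a:]" by (simp add: algebra_simps)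
  with \<open>a \<noteq> 0\<close> that show thesis by blast
qed

text \<open>Otherwise A F + B Q = c with c a nonzero polynomial in y and z alone. A zero of
  \<open>F\<close> above some (y, z) with c(y, z) nonzero contradicts the vanishing of
  \<open>Q\<close> there.\<close>

lemma dvd_if_vanishes_on_zeros:
  fixes F Q :: poly3
  assumes F: "irreducible F" "degree F > 0"
    and van: "\<And>v. v \<noteq> 0 \<Longrightarrow> eval3 F v = 0 \<Longrightarrow> eval3 Q v = 0"
  shows "F dvd Q"
proof (rule ccontr)
  assume "\<not> F dvd Q"
  moreover have "prime_elem F" using F(1) by (rule irreducible_imp_prime_poly)
  ultimately obtain A B c where c: "c \<noteq> 0" "A * F + B * Q = [:c:]"
    using F(2) by (auto elim: prime_elem_bezout_const)
  \<comment> \<open>The factor \<open>[:0, 1:]\<close> is the variable y; it keeps the zero of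
    \<open>F\<close> found below away from the origin.\<close>
  have "c * lead_coeff F * [:0, 1:] \<noteq> 0"
    using c F(2) by auto
  then obtain y z where yz: "eval2 (c * lead_coeff F * [:0, 1:]) y z \<noteq> 0"
    by (rule eval2_nonzero_point)
  then have lc: "eval2 (lead_coeff F) y z \<noteq> 0" by (auto simp: eval2_pCons)
  obtain x where x: "eval3 F (vector [x, y, z]) = 0" by (rule eval3_root_over[OF F(2) lc])
  have "y \<noteq> 0" using yz by (auto simp: eval2_def)
  then have "(vector [x, y, z] :: complex^3) \<noteq> 0" by (auto simp: vec_eq_iff forall_3)
  with x van have "eval3 Q (vector [x, y, z]) = 0" by blast
  then have "eval3 (A * F + B * Q) (vector [x, y, z]) = 0" using x by simp
  then have "eval2 c y z = 0" unfolding c(2) by (simp add: eval3_def eval2_def)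
  with yz show False by (simp add: eval2_pCons)
qed

subsection \<open>Differentiation along a curve\<close>

lemma eval3_pCons: "eval3 (pCons f G) v = eval2 f (v $ 2) (v $ 3) + v $ 1 * eval3 G v"
  by (simp add: eval3_def eval2_def)

lemma eval2_has_derivative:
  fixes y z :: "'a::real_normed_vector \<Rightarrow> complex"
  assumes y: "(y has_derivative y') (at p)" and z: "(z has_derivative z') (at p)"
  shows "((\<lambda>p. eval2 f (y p) (z p)) has_derivative
           (\<lambda>h. eval2 (pderiv f) (y p) (z p) * y' h + eval2 (map_poly pderiv f) (y p) (z p) * z' h))
         (at p)"
proof (induction f)
  case 0
  then show ?case by simp
next
  case (pCons c f)
  have "((\<lambda>p. poly c (z p)) has_derivative (\<lambda>h. poly (pderiv c) (z p) * z' h)) (at p)"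
    using has_derivative_compose[OF z, of "poly c" "(*) (poly (pderiv c) (z p))"] poly_DERIV
    by (auto simp: has_field_derivative_def)
  then show ?case
    unfolding eval2_pCons
    by (rule has_derivative_eq_rhs[OF has_derivative_add[OF _ has_derivative_mult[OF y pCons.IH]]])
      (simp_all add: fun_eq_iff pderiv_pCons map_poly_pCons eval2_pCons algebra_simps)
qed

text \<open>The parameter space is general because it is the complex line for curves and the product
  of two complex lines for the implicit function theorem.\<close>

lemma eval3_has_derivative:
  fixes u u' :: "'a::real_normed_vector \<Rightarrow> complex^3"
  assumes u: "\<And>n. ((\<lambda>p. u p $ n) has_derivative (\<lambda>h. u' h $ n)) (at p)"
  shows "((\<lambda>p. eval3 F (u p)) has_derivative (\<lambda>h. bilin (gradient F (u p)) (u' h))) (at p)"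
proof -
  have "((\<lambda>p. eval3 F (u p)) has_derivative
      (\<lambda>h. eval3 (pderiv F) (u p) * u' h $ 1 + eval3 (map_poly pderiv F) (u p) * u' h $ 2 +
        eval3 (map_poly (map_poly pderiv) F) (u p) * u' h $ 3)) (at p)"
  proof (induction F)
    case 0
    then show ?case by simp
  next
    case (pCons f F)
    show ?case
      unfolding eval3_pCons
      by (rule has_derivative_eq_rhs[OF has_derivative_add[OF
            eval2_has_derivative[OF u u] has_derivative_mult[OF u pCons.IH]]])
        (simp add: fun_eq_iff pderiv_pCons map_poly_pCons eval3_pCons algebra_simps)
  qed
  then show ?thesis by (simp add: bilin_def gradient_def pdiff_def sum_3)
qed

lemma eval3_has_field_derivative:
  fixes u :: "complex \<Rightarrow> complex^3" and u' :: "complex^3"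
  assumes "\<And>n. ((\<lambda>t. u t $ n) has_field_derivative u' $ n) (at t)"
  shows "((\<lambda>t. eval3 F (u t)) has_field_derivative bilin (gradient F (u t)) u') (at t)"
proof -
  have "((\<lambda>t. u t $ n) has_derivative (\<lambda>h. (h *s u') $ n)) (at t)" for n
    by (rule has_derivative_eq_rhs[OF assms[of n, unfolded has_field_derivative_def]])
      (simp add: fun_eq_iff mult.commute)
  then have "((\<lambda>t. eval3 F (u t)) has_derivative (\<lambda>h. bilin (gradient F (u t)) (h *s u'))) (at t)"
    by (rule eval3_has_derivative)
  moreover have "(\<lambda>h. bilin (gradient F (u t)) (h *s u')) = (*) (bilin (gradient F (u t)) u')"
    by (simp add: fun_eq_iff bilin_def sum_distrib_left mult_ac)
  ultimately show ?thesis by (simp add: has_field_derivative_def)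
qed

lemma eval3_line_has_field_derivative:
  "((\<lambda>t. eval3 F (a + t *s b)) has_field_derivative bilin (gradient F (a + t *s b)) b) (at t)"
  by (rule eval3_has_field_derivative) (auto intro!: derivative_eq_intros)

text \<open>Comparing both sides of \<open>G = F * A\<close> at \<open>t v\<close> as \<open>t\<close> tends to 0.\<close>

lemma homogeneous_dvd_degree_le:
  assumes "homogeneous d F" "homogeneous e G" "F dvd G" "G \<noteq> 0"
  shows "d \<le> e"
proof (rule ccontr)
  assume "\<not> d \<le> e"
  then obtain k where k: "d = e + Suc k" by (metis less_imp_Suc_add not_le add_Suc_right)
  obtain A where A: "G = F * A" using assms(3) by (auto elim: dvdE)
  obtain v where v: "eval3 G v \<noteq> 0" using eval3_nonzero_point[OF assms(4)] by blast
  define h where "h = (\<lambda>t. t ^ Suc k * eval3 F v * eval3 A (0 + t *s v))"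
  have "(\<lambda>t. eval3 A (0 + t *s v)) \<midarrow>0\<rightarrow> eval3 A (0 + 0 *s v)"
    by (rule isContD[OF DERIV_isCont[OF eval3_line_has_field_derivative]])
  then have "h \<midarrow>0\<rightarrow> 0 ^ Suc k * eval3 F v * eval3 A (0 + 0 *s v)"
    unfolding h_def by (intro tendsto_intros)
  then have "h \<midarrow>0\<rightarrow> 0" by simp
  moreover have "h t = eval3 G v" if "t \<noteq> 0" for t
  proof -
    have "t ^ e * eval3 G v = eval3 G (t *s v)" by (rule eval3_scale[OF assms(2), symmetric])
    also have "\<dots> = t ^ d * eval3 F v * eval3 A (t *s v)"
      by (simp add: A eval3_scale[OF assms(1)])
    also have "\<dots> = t ^ e * h t" by (simp add: k h_def power_add)
    finally show ?thesis using that by simp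
  qed
  then have "h \<midarrow>0\<rightarrow> eval3 G v"
    by (intro tendsto_eventually) (auto simp: eventually_at_filter)
  ultimately have "eval3 G v = 0" by (metis LIM_unique)
  with v show False by simp
qed

text \<open>Differentiate F(t v) = t^d F(v) at t = 1.\<close>

lemma homogeneous_euler:
  assumes "homogeneous d F"
  shows "bilin v (gradient F v) = of_nat d * eval3 F v"
proof -
  have "((\<lambda>t. eval3 F (0 + t *s v)) has_field_derivative bilin (gradient F (0 + 1 *s v)) v) (at 1)"
    by (rule eval3_line_has_field_derivative)
  moreover have "((\<lambda>t. t ^ d * eval3 F v) has_field_derivative of_nat d * eval3 F v) (at 1)"
    by (auto intro!: derivative_eq_intros)
  ultimately show ?thesis
    by (simp add: eval3_scale[OF assms] DERIV_unique bilin_def mult.commute)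
qed

lemma pdiff_commute: "pdiff m (pdiff n F) = pdiff n (pdiff m F)"
proof -
  have *: "coeff (of_nat n * p) k = of_nat n * coeff p k" for n k and p :: "complex poly"
    by (simp add: of_nat_poly)
  have **: "coeff (of_nat n * p) k = of_nat n * coeff p k" for n k and p :: "complex poly poly"
    by (simp add: of_nat_poly)
  show ?thesis
    by (intro poly_eqI)
      (simp add: pdiff_def coeff_pderiv coeff_map_poly * ** mult_ac del: of_nat_Suc)
qed

subsection \<open>The cross product over the complex numbers\<close>

text \<open>Bilinear, without conjugation: for the coordinate vectors of two distinct lines it gives
  their point of intersection.\<close>

definition cprod :: "complex^3 \<Rightarrow> complex^3 \<Rightarrow> complex^3" where
  "cprod u v = vector [u$2 * v$3 - u$3 * v$2, u$3 * v$1 - u$1 * v$3, u$1 * v$2 - u$2 * v$1]"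

lemma bilin_3: "bilin u v = u$1 * v$1 + u$2 * v$2 + u$3 * v$3"
  by (simp add: bilin_def sum_3)

lemma smult_add_smult_vector:
  "k *s (a *s vector [x, y, z] + b *s vector [x', y', z']) =
    (vector [k * (a * x + b * x'), k * (a * y + b * y'), k * (a * z + b * z')] :: complex^3)"
  by (simp add: vec_eq_iff forall_3 algebra_simps)

text \<open>The entries of \<open>cprod u v\<close> are the 2x2 minors of the pair; if they all
  vanish, then v_k u - u_k v = 0 for every index k.\<close>

lemma lin_indep2_iff_cprod: "lin_indep2 u v \<longleftrightarrow> cprod u v \<noteq> 0"
proof
  assume ind: "lin_indep2 u v"
  show "cprod u v \<noteq> 0"
  proof
    assume "cprod u v = 0"
    then have "v $ k *s u + (- u $ k) *s v = 0" for k
      using exhaust_3[of k] by (auto simp: cprod_def vec_eq_iff forall_3 algebra_simps)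
    then have "- u $ k = 0" for k using ind unfolding lin_indep2_def by blast
    then have "u = 0" by (simp add: vec_eq_iff)
    then have "1 *s u + 0 *s v = 0" by simp
    with ind show False unfolding lin_indep2_def by (metis one_neq_zero)
  qed
next
  assume c: "cprod u v \<noteq> 0"
  show "lin_indep2 u v"
    unfolding lin_indep2_def
  proof (intro allI impI)
    fix a b assume ab: "a *s u + b *s v = 0"
    have "a *s cprod u v = cprod (a *s u + b *s v) v" "b *s cprod u v = cprod u (a *s u + b *s v)"
      by (simp_all add: cprod_def vec_eq_iff forall_3 algebra_simps)
    moreover have "cprod 0 v = 0" "cprod u 0 = 0"
      by (simp_all add: cprod_def vec_eq_iff forall_3)
    ultimately have "a *s cprod u v = 0" "b *s cprod u v = 0"
      by (simp_all only: ab)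
    with c show "a = 0 \<and> b = 0" by simp
  qed
qed

lemma cprod_eq_0_imp_multiple:
  assumes "cprod w u = 0" "w \<noteq> 0"
  shows "\<exists>c. u = c *s w"
proof -
  obtain k where k: "w $ k \<noteq> 0" using assms(2) by (auto simp: vec_eq_iff)
  have "u = (u $ k / w $ k) *s w"
    using assms(1) k exhaust_3[of k]
    by (auto simp: cprod_def vec_eq_iff forall_3 field_simps)
  then show ?thesis by blast
qed

text \<open>Two distinct lines meet in a single point, by the identity (a x b) x u = <a,u> b - <b,u>
  a.\<close>

lemma orthogonal_imp_multiple_cprod:
  assumes "cprod a b \<noteq> 0" "bilin a u = 0" "bilin b u = 0"
  shows "\<exists>c. u = c *s cprod a b"
proof (rule cprod_eq_0_imp_multiple[OF _ assms(1)])
  have "cprod (cprod a b) u = bilin a u *s b - bilin b u *s a"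
    by (simp add: cprod_def vec_eq_iff forall_3 bilin_3 algebra_simps)
  then show "cprod (cprod a b) u = 0" by (simp add: assms)
qed

lemma bilin_cprod: "bilin a (cprod a b) = 0" "bilin b (cprod a b) = 0"
  by (simp_all add: cprod_def bilin_3 algebra_simps)

lemma bilin_smult_right: "bilin a (c *s b) = c * bilin a b"
  by (simp add: bilin_3 algebra_simps)

lemma curve_proj_iff:
  assumes "homogeneous d F" "v \<noteq> 0"
  shows "proj v \<in> curve F \<longleftrightarrow> eval3 F v = 0"
  using assms
  by (auto simp: zero_locus_def eval3_scale[OF assms(1)] proj_eq_iff)

lemma proj_in_proj_line_iff:
  assumes "v \<noteq> 0"
  shows "proj v \<in> proj_line w \<longleftrightarrow> bilin w v = 0"
proof
  assume "proj v \<in> proj_line w"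
  then obtain u where "proj v = proj u" "u \<noteq> 0" "bilin w u = 0" by (auto simp: proj_line_def)
  then show "bilin w v = 0"
    using proj_eq_iff[of u v] assms by (auto simp: bilin_smult_right)
qed (use assms in \<open>auto simp: proj_line_def\<close>)

subsection \<open>The reflected line in affine coordinates\<close>

text \<open>On \<open>z = 1\<close> both branches of \<open>rho_tilde\<close> agree, and the reflected line passes through the
  point of incidence, which gives its last coefficient.\<close>

lemma rho_tilde_affine:
  fixes F :: poly3 and S :: "complex^3" and X Y :: complex
  defines "g \<equiv> gradient F (vector [X, Y, 1])"
  defines "a \<equiv> S$1 - S$3 * X" and "b \<equiv> S$3 * Y - S$2"
  defines "P \<equiv> (g$1)^2 - (g$2)^2" and "Q \<equiv> 2 * g$1 * g$2"
  shows "rho_tilde F S (vector [X, Y, 1]) =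
    vector [b * P + a * Q, b * Q - a * P, - (X * (b * P + a * Q) + Y * (b * Q - a * P))]"
  unfolding rho_tilde_def Let_def vector_3 g_def[symmetric]
  by (cases "S$3 = 0")
     (simp_all add: vec_eq_iff forall_3 a_def b_def P_def Q_def power2_eq_square algebra_simps)

text \<open>The Hessian determinant after eliminating its last row and column by the Euler relations.\<close>

lemma euler_reduced_det:
  fixes a b c x y e p q A31 A32 A33 r :: "'a::comm_ring_1"
  assumes 1: "A31 = e * p - x * a - y * b" and 2: "A32 = e * q - x * b - y * c"
   and 3: "A33 = e * r - x * A31 - y * A32" and 4: "r = - (x * p + y * q)"
  shows "a * c * A33 + b * A32 * A31 + A31 * b * A32 - a * A32 * A32 - b * b * A33 - A31 * c * A31
    = - (e^2 * (q^2 * a - 2 * p * q * b + p^2 * c))"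
proof -
  have 5: "a * A32 - b * A31 = e * (a * q - b * p) - y * (a * c - b * b)"
    unfolding 1 2 by (simp add: algebra_simps)
  have 6: "c * A31 - b * A32 = e * (c * p - b * q) - x * (a * c - b * b)"
    unfolding 1 2 by (simp add: algebra_simps)
  have "a * c * A33 + b * A32 * A31 + A31 * b * A32 - a * A32 * A32 - b * b * A33 - A31 * c * A31 =
    (a * c - b * b) * A33 - A32 * (a * A32 - b * A31) - A31 * (c * A31 - b * A32)"
    by (simp add: algebra_simps)
  also have "\<dots> = (a * c - b * b) * (e * r) - e * (A32 * (a * q - b * p) + A31 * (c * p - b * q))"
    unfolding 5 6 3 by (simp add: algebra_simps)
  also have "A32 * (a * q - b * p) + A31 * (c * p - b * q) = 
     e * (q^2 * a - 2 * p * q * b + p^2 * c) - (a * c - b * b) * (x * p + y * q)"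
    unfolding 1 2 by (simp add: algebra_simps power2_eq_square)
  finally show ?thesis unfolding 4 by (simp add: algebra_simps power2_eq_square)
qed
text \<open>Euler's relation for \<open>F\<close> gives F_z, and for each \<open>pdiff n F\<close>,
  of degree d - 1, it gives the last row of the Hessian matrix. The factor (d - 1)^2 is the one that
  \<open>Phi_tilde\<close> divides by.\<close>

lemma hessian_affine:
  fixes F :: poly3 and v :: "complex^3" and X Y :: complex
  assumes F: "homogeneous d F" "d \<ge> 1"
    and v: "v = vector [X, Y, 1]" "eval3 F v = 0"
  defines "h \<equiv> \<lambda>m n. eval3 (pdiff m (pdiff n F)) v"
  defines "g \<equiv> gradient F v"
  shows "hessian F v = - ((of_nat d - 1)^2 *
    ((g$2)^2 * h 1 1 - 2 * g$1 * g$2 * h 1 2 + (g$1)^2 * h 2 2))"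
    and "g$3 = - (X * g$1 + Y * g$2)"
proof -
  define e :: complex where "e = of_nat d - 1"
  have d: "of_nat (d - 1) = e" using F(2) by (simp add: e_def of_nat_diff)
  have sym: "h m n = h n m" for m n by (simp add: h_def pdiff_commute[of m])
  have gr: "gradient (pdiff n F) v = (\<chi> m. h m n)" for n
    by (simp add: gradient_def h_def)
  have h: "X * h 1 n + Y * h 2 n + h 3 n = e * g$n" for n
    using homogeneous_euler[OF homogeneous_pdiff[OF F(1), of n], of v]
    unfolding gr d by (simp add: bilin_3 v(1) g_def gradient_def)
  show g: "g$3 = - (X * g$1 + Y * g$2)"
    using homogeneous_euler[OF F(1), of v] v
    by (simp add: bilin_3 g_def eq_neg_iff_add_eq_0 add_ac del: minus_add_distrib)
  have h3: "h 3 1 = e * g$1 - X * h 1 1 - Y * h 1 2" "h 3 2 = e * g$2 - X * h 1 2 - Y * h 2 2"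
    using h[of 1] h[of 2] by (simp_all add: sym algebra_simps)
  have h33: "h 3 3 = e * g$3 - X * h 3 1 - Y * h 3 2"
    using h[of 3] by (simp add: sym[of 1 3] sym[of 2 3] algebra_simps)
  have "hessian F v = det (\<chi> m n. h m n)"
    by (simp add: hessian_def h_def)
  also have "\<dots> = - (e^2 * ((g$2)^2 * h 1 1 - 2 * g$1 * g$2 * h 1 2 + (g$1)^2 * h 2 2))"
    unfolding det_3 vec_lambda_beta sym[of 1 3] sym[of 2 3] sym[of 2 1]
    by (rule euler_reduced_det[OF h3 h33 g])
  finally show "hessian F v = - ((of_nat d - 1)^2 *
    ((g$2)^2 * h 1 1 - 2 * g$1 * g$2 * h 1 2 + (g$1)^2 * h 2 2))"
    by (simp add: e_def)
qed

text \<open>The third component comes from \<open>r\<^sub>1 + i r\<^sub>2 = (b - i a) (F\<^sub>x + i F\<^sub>y)\<^sup>2\<close>; the other two follow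
  from it since \<open>r\<close> is orthogonal to \<open>(X, Y, 1)\<close>.\<close>

lemma cprod_reflected_line:
  fixes X Y X' Y' :: complex
  assumes X': "X' = \<tau> * Fy" and Y': "Y' = - \<tau> * Fx"
    and a: "a = x0 - z0 * X" and b: "b = z0 * Y - y0"
    and a': "a' = - z0 * X'" and b': "b' = z0 * Y'"
    and Fx': "Fx' = h11 * X' + h12 * Y'" and Fy': "Fy' = h12 * X' + h22 * Y'"
    and P: "P = Fx^2 - Fy^2" and Q: "Q = 2 * Fx * Fy"
    and P': "P' = 2 * Fx * Fx' - 2 * Fy * Fy'" and Q': "Q' = 2 * (Fx' * Fy + Fx * Fy')"
    and r1: "r1 = b * P + a * Q" and r2: "r2 = b * Q - a * P"
    and r1': "r1' = b' * P + b * P' + a' * Q + a * Q'"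
    and r2': "r2' = b' * Q + b * Q' - a' * P - a * P'"
    and Fz: "Fz = - (X * Fx + Y * Fy)"
    and D: "D = x0 * Fx + y0 * Fy + z0 * Fz"
    and K: "K = Fy^2 * h11 - 2 * Fx * Fy * h12 + Fx^2 * h22"
    and N: "N = (X * z0 - x0)^2 + (Y * z0 - y0)^2"
  shows "cprod (vector [r1, r2, - (X * r1 + Y * r2)])
               (vector [r1', r2', - (X' * r1 + X * r1' + Y' * r2 + Y * r2')]) =
    (- (\<tau> * (Fx^2 + Fy^2))) *s
      ((2 * K * N) *s vector [X, Y, 1] + D *s
        vector [Fy^2 * x0 - Fx^2 * x0 - 2 * Fx * Fy * y0 - 2 * Fx * Fz * z0,
                Fx^2 * y0 - Fy^2 * y0 - 2 * Fx * Fy * x0 - 2 * Fy * Fz * z0,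
                z0 * (Fx^2 + Fy^2)])"
proof -
  define R where "R = Fx^2 + Fy^2"
  define c3 where "c3 = r1 * r2' - r2 * r1'"
  have Dab: "D = a * Fx - b * Fy"
    unfolding D Fz a b by (simp add: algebra_simps)
  have e: "X' * r1 + Y' * r2 = \<tau> * D * R"
    unfolding Dab X' Y' r1 r2 P Q R_def by (simp add: algebra_simps power2_eq_square)
  \<comment> \<open>P + i Q = (F_x + i F_y)^2, so \<open>PQ\<close> and \<open>PQ'\<close> are the
    squared norm and the Wronskian of a square.\<close>
  have PQ: "P^2 + Q^2 = R^2"
    unfolding P Q R_def by (simp add: algebra_simps power2_eq_square)
  have PQ': "P * Q' - Q * P' = - 2 * R * \<tau> * K"
    unfolding P Q P' Q' R_def K Fx' Fy' X' Y' by (simp add: algebra_simps power2_eq_square)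
  have ab: "a * b' - b * a' = - (\<tau> * z0 * D)"
    unfolding Dab a' b' X' Y' by (simp add: algebra_simps)
  have N': "a^2 + b^2 = N"
    unfolding N a b by (simp add: algebra_simps power2_eq_square)
  \<comment> \<open>Since r1 + i r2 = (b - i a)(P + i Q), the Wronskian c3 is the sum of the
    Wronskians of the two factors, each multiplied by the squared norm of the other factor.\<close>
  have "c3 = (P^2 + Q^2) * (a * b' - b * a') + (a^2 + b^2) * (P * Q' - Q * P')"
    unfolding c3_def r1 r2 r1' r2' by (simp add: algebra_simps power2_eq_square)
  also have "\<dots> = (- (\<tau> * R)) * (2 * K * N + D * (z0 * R))"
    unfolding PQ PQ' ab N' by (simp add: algebra_simps power2_eq_square)
  finally have c3: "c3 = (- (\<tau> * R)) * (2 * K * N + D * (z0 * R))" .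
  \<comment> \<open>By Euler's relation \<open>Fz\<close>, the vector multiplied by Delta_S F in
    \<open>Phi_tilde\<close> equals z0 R (X, Y, 1) + (r2, -r1, 0).\<close>
  have w1: "z0 * R * X + r2 =
      Fy^2 * x0 - Fx^2 * x0 - 2 * Fx * Fy * y0 - 2 * Fx * Fz * z0"
    unfolding R_def r2 a b P Q Fz by (simp add: algebra_simps power2_eq_square)
  have w2: "z0 * R * Y - r1 =
      Fx^2 * y0 - Fy^2 * y0 - 2 * Fx * Fy * x0 - 2 * Fy * Fz * z0"
    unfolding R_def r1 a b P Q Fz by (simp add: algebra_simps power2_eq_square)
  have c1: "r2 * - (X' * r1 + X * r1' + Y' * r2 + Y * r2') - - (X * r1 + Y * r2) * r2' =
      X * c3 - r2 * (X' * r1 + Y' * r2)"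
    by (simp add: c3_def algebra_simps)
  have c2: "- (X * r1 + Y * r2) * r1' - r1 * - (X' * r1 + X * r1' + Y' * r2 + Y * r2') =
      Y * c3 + r1 * (X' * r1 + Y' * r2)"
    by (simp add: c3_def algebra_simps)
  have k1: "X * c3 - r2 * (\<tau> * D * R) = (- (\<tau> * R)) * (2 * K * N * X + D * (z0 * R * X + r2))"
    and k2: "Y * c3 + r1 * (\<tau> * D * R) = (- (\<tau> * R)) * (2 * K * N * Y + D * (z0 * R * Y - r1))"
    unfolding c3 by algebra+
  have "cprod (vector [r1, r2, - (X * r1 + Y * r2)])
               (vector [r1', r2', - (X' * r1 + X * r1' + Y' * r2 + Y * r2')]) =
      vector [(- (\<tau> * R)) * (2 * K * N * X + D * (z0 * R * X + r2)),
              (- (\<tau> * R)) * (2 * K * N * Y + D * (z0 * R * Y - r1)),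
              (- (\<tau> * R)) * (2 * K * N * 1 + D * (z0 * R))]"
    unfolding cprod_def
    by (simp only: vector_3 c1 c2 e k1 k2 c3_def[symmetric]) (simp only: c3 mult_1_right)
  also have "\<dots> = (- (\<tau> * R)) *s
      ((2 * K * N) *s vector [X, Y, 1] + D *s vector [z0 * R * X + r2, z0 * R * Y - r1, z0 * R])"
    by (simp only: smult_add_smult_vector)
  finally show ?thesis unfolding w1 w2 unfolding R_def .
qed

subsection \<open>The contact point\<close>

lemma affine_point_nonzero: "(vector [X, Y, 1] :: complex^3) \<noteq> 0"
  by (simp add: vec_eq_iff forall_3)

text \<open>The parametrization enters only through the nonzero scalar \<tau>, so the contact point,
  when defined, does not depend on it.\<close>

lemma contact_cprod:
  fixes F :: poly3 and S :: "complex^3" and x y :: "complex \<Rightarrow> complex"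
  assumes F: "homogeneous d F" "d \<ge> 2"
    and par: "regular_local_param F m x y"
  defines "v \<equiv> vector [x 0, y 0, 1]"
  defines "r \<equiv> \<lambda>t. rho_tilde F S (vector [x t, y t, 1])"
  defines "r' \<equiv> \<chi> n. deriv (\<lambda>t. r t $ n) 0"
  assumes grad: "gradient F v \<noteq> 0"
  obtains \<tau> where "\<tau> \<noteq> 0" "cprod (r 0) r' =
    (- (\<tau> * ((gradient F v $ 1)^2 + (gradient F v $ 2)^2))) *s Phi_tilde d F S v"
proof -
  define u :: "complex \<Rightarrow> complex^3" where "u = (\<lambda>t. vector [x t, y t, 1])"
  define X' where "X' = deriv x 0"
  define Y' where "Y' = deriv y 0"
  obtain e where e: "e > 0" "x holomorphic_on ball 0 e" "y holomorphic_on ball 0 e"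
      "\<And>t. t \<in> ball 0 e \<Longrightarrow> proj (u t) \<in> curve F"
    using par by (auto simp: regular_local_param_def u_def)
  have X'Y': "X' \<noteq> 0 \<or> Y' \<noteq> 0"
    using par by (auto simp: regular_local_param_def X'_def Y'_def)
  have x: "(x has_field_derivative X') (at 0)" and y: "(y has_field_derivative Y') (at 0)"
    unfolding X'_def Y'_def
    using holomorphic_derivI[OF e(2) open_ball, of 0] holomorphic_derivI[OF e(3) open_ball, of 0] e(1)
    by simp_all
  have u: "((\<lambda>t. u t $ n) has_field_derivative (vector [X', Y', 0] :: complex^3) $ n) (at 0)" for n
    using exhaust_3[of n] x y by (auto simp: u_def)
  have u0: "u 0 = v" by (simp add: u_def v_def)
  have van: "eval3 F (u t) = 0" if "t \<in> ball 0 e" for t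
    using e(4)[OF that] curve_proj_iff[OF F(1)] affine_point_nonzero by (simp add: u_def)
  have deriv_eval: "((\<lambda>t. eval3 G (u t)) has_field_derivative
      eval3 (pdiff 1 G) v * X' + eval3 (pdiff 2 G) v * Y') (at 0)" for G
    using eval3_has_field_derivative[OF u, of G] by (simp add: u0 bilin_3 gradient_def)
  define g where "g = gradient F v"
  define h where "h = (\<lambda>m n. eval3 (pdiff m (pdiff n F)) v)"
  have Fv: "eval3 F v = 0" using van[of 0] e(1) by (simp add: u0)
  have d: "d \<ge> 1" using F(2) by simp
  have H: "hessian F v = - ((of_nat d - 1)^2 *
      ((g$2)^2 * h 1 1 - 2 * g$1 * g$2 * h 1 2 + (g$1)^2 * h 2 2))"
    and Fz: "g$3 = - (x 0 * g$1 + y 0 * g$2)"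
    using hessian_affine[OF F(1) d v_def[THEN meta_eq_to_obj_eq] Fv]
    by (simp_all add: g_def h_def)
  \<comment> \<open>\<open>F\<close> vanishes identically along the parametrization, so its velocity
    is tangent to the curve.\<close>
  have "((\<lambda>t. eval3 F (u t)) has_field_derivative 0) (at 0)"
    by (rule has_field_derivative_transform_within[OF DERIV_const[of 0] e(1)])
      (use van in \<open>auto simp: dist_commute\<close>)
  from DERIV_unique[OF deriv_eval this] have tan: "g$1 * X' + g$2 * Y' = 0"
    by (simp add: g_def gradient_def)
  \<comment> \<open>\<open>Fz\<close> expresses F_z through F_x and F_y, so a nonzero gradient
    cannot have both of these equal to zero.\<close>
  have g12: "g$1 \<noteq> 0 \<or> g$2 \<noteq> 0"
    using grad Fz by (auto simp: g_def vec_eq_iff forall_3)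
  define \<tau> where "\<tau> = (if g$2 \<noteq> 0 then X' / g$2 else - Y' / g$1)"
  have X': "X' = \<tau> * g$2" and Y': "Y' = - \<tau> * g$1"
    using g12 tan by (auto simp: \<tau>_def field_simps eq_neg_iff_add_eq_0)
  have "\<tau> \<noteq> 0" using X'Y' X' Y' by auto
  define p where "p = (\<lambda>n t. eval3 (pdiff n F) (u t))"
  define p' where "p' = (\<lambda>n. h 1 n * X' + h 2 n * Y')"
  have p: "(p n has_field_derivative p' n) (at 0)" for n
    unfolding p_def p'_def h_def by (rule deriv_eval)
  have p0: "p n 0 = g $ n" for n by (simp add: p_def g_def gradient_def u0)
  define a where "a = (\<lambda>t. S$1 - S$3 * x t)"
  define b where "b = (\<lambda>t. S$3 * y t - S$2)"
  define P where "P = (\<lambda>t. (p 1 t)^2 - (p 2 t)^2)"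
  define Q where "Q = (\<lambda>t. 2 * p 1 t * p 2 t)"
  define r1 where "r1 = (\<lambda>t. b t * P t + a t * Q t)"
  define r2 where "r2 = (\<lambda>t. b t * Q t - a t * P t)"
  define P' where "P' = 2 * g$1 * p' 1 - 2 * g$2 * p' 2"
  define Q' where "Q' = 2 * (p' 1 * g$2 + g$1 * p' 2)"
  define a' where "a' = - S$3 * X'"
  define b' where "b' = S$3 * Y'"
  define r1' where "r1' = b' * P 0 + b 0 * P' + a' * Q 0 + a 0 * Q'"
  define r2' where "r2' = b' * Q 0 + b 0 * Q' - a' * P 0 - a 0 * P'"
  have r: "r t = vector [r1 t, r2 t, - (x t * r1 t + y t * r2 t)]" for t
    unfolding r_def rho_tilde_affine r1_def r2_def a_def b_def P_def Q_def p_def u_def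
    by (simp add: gradient_def)
  have da: "(a has_field_derivative a') (at 0)" and db: "(b has_field_derivative b') (at 0)"
    unfolding a_def a'_def b_def b'_def by (auto intro!: derivative_eq_intros x y)
  have dP: "(P has_field_derivative P') (at 0)" and dQ: "(Q has_field_derivative Q') (at 0)"
    unfolding P_def P'_def Q_def Q'_def
    by (auto intro!: derivative_eq_intros p simp: p0 algebra_simps)
  have dr1: "(r1 has_field_derivative r1') (at 0)" and dr2: "(r2 has_field_derivative r2') (at 0)"
    unfolding r1_def r1'_def r2_def r2'_def
    by (auto intro!: derivative_eq_intros da db dP dQ simp: algebra_simps)
  have dr3: "((\<lambda>t. - (x t * r1 t + y t * r2 t)) has_field_derivative
      - (X' * r1 0 + x 0 * r1' + Y' * r2 0 + y 0 * r2')) (at 0)"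
    by (auto intro!: derivative_eq_intros x y dr1 dr2 simp: algebra_simps)
  have r': "r' = vector [r1', r2', - (X' * r1 0 + x 0 * r1' + Y' * r2 0 + y 0 * r2')]"
    using DERIV_imp_deriv[OF dr1] DERIV_imp_deriv[OF dr2] DERIV_imp_deriv[OF dr3]
    by (simp add: r'_def vec_eq_iff forall_3 r)
  define D where "D = S$1 * g$1 + S$2 * g$2 + S$3 * g$3"
  define K where "K = (g$2)^2 * h 1 1 - 2 * g$1 * g$2 * h 1 2 + (g$1)^2 * h 2 2"
  define N where "N = (x 0 * S$3 - S$1)^2 + (y 0 * S$3 - S$2)^2"
  have h21: "h 2 1 = h 1 2" by (simp add: h_def pdiff_commute[of 2])
  have "(of_nat d - 1 :: complex) \<noteq> 0"
    using F(2) by (metis One_nat_def Suc_1 not_less_eq_eq of_nat_1 of_nat_eq_iff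
        order_refl right_minus_eq)
  then have c: "- (2 * hessian F v * N_poly S v / (of_nat d - 1)^2) = 2 * K * N"
    unfolding H K_def[symmetric] by (simp add: N_poly_def N_def v_def)
  have "cprod (r 0) r' = (- (\<tau> * ((g$1)^2 + (g$2)^2))) *s
      ((2 * K * N) *s vector [x 0, y 0, 1] + D *s
        vector [(g$2)^2 * S$1 - (g$1)^2 * S$1 - 2 * g$1 * g$2 * S$2 - 2 * g$1 * g$3 * S$3,
                (g$1)^2 * S$2 - (g$2)^2 * S$2 - 2 * g$1 * g$2 * S$1 - 2 * g$2 * g$3 * S$3,
                S$3 * ((g$1)^2 + (g$2)^2)])"
    unfolding r r'
    by (rule cprod_reflected_line[where a = "a 0" and b = "b 0" and P = "P 0" and Q = "Q 0"
          and a' = a' and b' = b' and P' = P' and Q' = Q' and Fx' = "p' 1" and Fy' = "p' 2"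
          and ?h11.0 = "h 1 1" and ?h12.0 = "h 1 2" and ?h22.0 = "h 2 2"])
      (use X' Y' Fz in \<open>simp_all add: a_def b_def a'_def b'_def p'_def h21 P_def Q_def p0 P'_def
        Q'_def r1_def r2_def r1'_def r2'_def D_def K_def N_def\<close>)
  also have "\<dots> = (- (\<tau> * ((g$1)^2 + (g$2)^2))) *s Phi_tilde d F S v"
    unfolding Phi_tilde_def Let_def c by (simp add: Delta_def bilin_3 D_def g_def v_def)
  finally show thesis using that \<open>\<tau> \<noteq> 0\<close> by (simp add: g_def)
qed

text \<open>Independence of r and r' makes their cross product nonzero, hence also
  \<open>Phi_tilde\<close>, of which it is a multiple. The two lines have no other common
  point.\<close>

lemma contact_point_eq_Phi:
  assumes F: "homogeneous d F" "d \<ge> 2"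
    and m: "m \<in> admissible_points F S" "contact_point F S m p"
  shows "m \<in> curve F" "Phi_defined d F S m" "p = Phi d F S m"
proof -
  obtain x y where par: "regular_local_param F m x y"
    and ind: "lin_indep2 (rho_tilde F S (vector [x 0, y 0, 1]))
       (\<chi> n. deriv (\<lambda>t. rho_tilde F S (vector [x t, y t, 1]) $ n) 0)"
    and p1: "p \<in> reflected_line F S (vector [x 0, y 0, 1])"
    and p2: "p \<in> proj_line (\<chi> n. deriv (\<lambda>t. rho_tilde F S (vector [x t, y t, 1]) $ n) 0)"
    using m(2) unfolding contact_point_def Let_def by blast
  define v :: "complex^3" where "v = vector [x 0, y 0, 1]"
  have v: "v \<noteq> 0" "m = proj v"
    using par by (auto simp: v_def affine_point_nonzero regular_local_param_def)
  obtain w where w: "w \<noteq> 0" "m = proj w" "m \<in> curve F" "gradient F w \<noteq> 0"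
    using m(1) by (auto simp: admissible_points_def Reg_def)
  obtain c where c: "w = c *s v" using proj_eq_iff[OF v(1) w(1)] v w by auto
  have grad: "gradient F v \<noteq> 0"
  proof
    assume "gradient F v = 0"
    then have "gradient F w = 0"
      using eval3_scale[OF homogeneous_pdiff[OF F(1)]]
      by (auto simp: gradient_def vec_eq_iff c)
    with w(4) show False by simp
  qed
  then obtain \<tau> where \<tau>: "\<tau> \<noteq> 0" "cprod (rho_tilde F S v)
      (\<chi> n. deriv (\<lambda>t. rho_tilde F S (vector [x t, y t, 1]) $ n) 0) =
      (- (\<tau> * ((gradient F v $ 1)^2 + (gradient F v $ 2)^2))) *s Phi_tilde d F S v"
    (is "cprod ?r ?r' = ?k *s _")
    unfolding v_def by (rule contact_cprod[OF F par])
  have nz: "cprod ?r ?r' \<noteq> 0" using ind unfolding v_def lin_indep2_iff_cprod .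
  then have Phi_nz: "Phi_tilde d F S v \<noteq> 0" and k: "?k \<noteq> 0" unfolding \<tau>(2) by auto
  show "m \<in> curve F" by (rule w(3))
  show "Phi_defined d F S m"
    using Phi_defined_proj[OF F v(1)] Phi_nz v(2) by simp
  obtain q where q: "q \<noteq> 0" "p = proj q"
    using p1 by (auto simp: reflected_line_def proj_line_def)
  have "bilin ?r q = 0" "bilin ?r' q = 0"
    using p1 p2 q(1) by (simp_all add: q(2) reflected_line_def proj_in_proj_line_iff v_def)
  from orthogonal_imp_multiple_cprod[OF nz this] obtain c' where "q = (c' * ?k) *s Phi_tilde d F S v"
    unfolding \<tau>(2) by (metis vector_smult_assoc)
  then have "proj (Phi_tilde d F S v) = p"
    unfolding q(2) proj_eq_iff[OF Phi_nz q(1)] by blast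
  then show "p = Phi d F S m" using Phi_proj[OF F v(1) Phi_nz] v(2) by simp
qed

subsection \<open>Existence of local parametrizations\<close>

text \<open>The inverse function theorem for \<Psi>(p) = (p_1, f(p)) gives s(t) as the second
  component of the preimage of (t, 0).\<close>

lemma holomorphic_implicit_function:
  fixes f f1 f2 :: "complex \<times> complex \<Rightarrow> complex"
  assumes der: "\<And>p. (f has_derivative (\<lambda>h. f1 p * fst h + f2 p * snd h)) (at p)"
    and cont: "continuous_on UNIV f1" "continuous_on UNIV f2"
    and f0: "f 0 = 0" "f2 0 \<noteq> 0"
  obtains s e where "e > 0" "s holomorphic_on ball 0 e" "s 0 = 0"
    "\<And>t. t \<in> ball 0 e \<Longrightarrow> f (t, s t) = 0"
proof -
  define D where "D = (\<lambda>p h. (fst h, f1 p * fst h + f2 p * snd h))"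
  define B where "B = (\<lambda>p. Blinfun (D p))"
  have bl: "bounded_linear (D p)" for p
    unfolding D_def
    by (intro bounded_linear_Pair bounded_linear_fst bounded_linear_add
        bounded_linear_mult_right[THEN bounded_linear_compose] bounded_linear_snd)
  then have B: "blinfun_apply (B p) = D p" for p
    by (simp add: B_def bounded_linear_Blinfun_apply)
  define \<Psi> where "\<Psi> = (\<lambda>p. (fst p, f p))"
  have der\<Psi>: "(\<Psi> has_derivative blinfun_apply (B p)) (at p)" for p
    unfolding B D_def \<Psi>_def by (auto intro!: derivative_eq_intros der)
  have contB: "continuous_on UNIV B"
    by (rule continuous_on_blinfun_componentwise)
      (auto simp: B D_def intro!: continuous_intros cont)
  define J where "J = (\<lambda>h. (fst h, (snd h - f1 0 * fst h) / f2 0))"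
  have "bounded_linear J"
    unfolding J_def divide_inverse
    by (intro bounded_linear_Pair bounded_linear_fst bounded_linear_sub
        bounded_linear_mult_right[THEN bounded_linear_compose]
        bounded_linear_mult_left[THEN bounded_linear_compose] bounded_linear_snd)
  then have "Blinfun J o\<^sub>L B 0 = id_blinfun"
    by (intro blinfun_eqI) (simp add: B bounded_linear_Blinfun_apply J_def D_def f0)
  then obtain U V g g' where UV: "open U" "U \<subseteq> UNIV" "0 \<in> U" "open V" "\<Psi> 0 \<in> V"
      "homeomorphism U V \<Psi> g"
    and g: "\<And>y. y \<in> V \<Longrightarrow> (g has_derivative g' y) (at y)"
    and g': "\<And>y. y \<in> V \<Longrightarrow> g' y = inv (blinfun_apply (B (g y)))"
    and bij: "\<And>y. y \<in> V \<Longrightarrow> bij (blinfun_apply (B (g y)))"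
    by (rule inverse_function_theorem[OF open_UNIV der\<Psi> contB UNIV_I]) (rule that)
  have \<Psi>0: "\<Psi> 0 = (0, 0)" by (simp add: \<Psi>_def f0)
  have "open ((\<lambda>t. (t, 0)) -` V)"
    by (intro open_vimage UV continuous_intros)
  moreover have "0 \<in> (\<lambda>t. (t, 0)) -` V" using UV(5) by (simp add: \<Psi>0)
  ultimately obtain e where e: "e > 0" "ball 0 e \<subseteq> (\<lambda>t. (t, 0)) -` V"
    by (meson openE)
  define s where "s = (\<lambda>t. snd (g (t, 0)))"
  have gt: "g (t, 0) = (t, s t)" "f (t, s t) = 0" if "t \<in> ball 0 e" for t
  proof -
    have "\<Psi> (g (t, 0)) = (t, 0)"
      using homeomorphism_apply2[OF UV(6)] e(2) that by auto
    then have *: "fst (g (t, 0)) = t" "f (g (t, 0)) = 0" by (simp_all add: \<Psi>_def)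
    then show "g (t, 0) = (t, s t)" by (simp add: s_def prod_eq_iff)
    with * show "f (t, s t) = 0" by simp
  qed
  have "(s has_field_derivative - f1 (t, s t) / f2 (t, s t)) (at t)" if t: "t \<in> ball 0 e" for t
  proof -
    have V: "(t, 0) \<in> V" using e(2) t by auto
    \<comment> \<open>Invertibility of the derivative of \<Psi> along the graph makes
      \<open>f2\<close> nonzero there. The derivative of \<open>s\<close> is then multiplication by
      a complex number, which is holomorphy.\<close>
    have inj: "inj (D (t, s t))"
      using bij[OF V] by (simp add: gt[OF t] B bij_def)
    have nz: "f2 (t, s t) \<noteq> 0"
    proof
      assume "f2 (t, s t) = 0"
      then have "D (t, s t) (0, 1) = D (t, s t) (0, 0)" by (simp add: D_def)
      from injD[OF inj this] show False by simp
    qed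
    have "g' (t, 0) (h, 0) = (h, - f1 (t, s t) / f2 (t, s t) * h)" for h
      unfolding g'[OF V] B gt[OF t]
      by (rule inv_f_eq[OF inj]) (use nz in \<open>simp add: D_def\<close>)
    moreover have "((\<lambda>t. g (t, 0)) has_derivative (\<lambda>h. g' (t, 0) (h, 0))) (at t)"
      by (rule has_derivative_compose[where f = "\<lambda>t. (t, 0)", OF _ g[OF V]])
        (auto intro!: derivative_eq_intros)
    then have "(s has_derivative (\<lambda>h. snd (g' (t, 0) (h, 0)))) (at t)"
      unfolding s_def by (rule has_derivative_snd)
    ultimately show ?thesis by (simp only: has_field_derivative_def snd_conv)
  qed
  then have "s holomorphic_on ball 0 e"
    unfolding holomorphic_on_open[OF open_ball] by blast
  moreover have "s 0 = 0"
    using homeomorphism_apply1[OF UV(6) UV(3)] by (simp add: \<Psi>0 s_def)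
  ultimately show thesis using that e(1) gt(2) by blast
qed

text \<open>Use the tangent direction (q, -p) and the normal direction (p, q) as coordinates at the
  point. They are independent because p^2 + q^2 is nonzero, and this avoids distinguishing F_x
  nonzero from F_y nonzero.\<close>

lemma regular_local_param_exists:
  fixes F :: poly3 and a b :: complex
  assumes F: "homogeneous d F"
  defines "w \<equiv> vector [a, b, 1]"
  assumes w: "eval3 F w = 0" and g: "(gradient F w $ 1)^2 + (gradient F w $ 2)^2 \<noteq> 0"
  obtains x y where "regular_local_param F (proj w) x y" "x 0 = a" "y 0 = b"
proof -
  define p where "p = gradient F w $ 1"
  define q where "q = gradient F w $ 2"
  define u :: "complex \<times> complex \<Rightarrow> complex^3"
    where "u = (\<lambda>h. vector [a + fst h * q + snd h * p, b - fst h * p + snd h * q, 1])"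
  define f where "f = (\<lambda>h. eval3 F (u h))"
  define f1 where "f1 = (\<lambda>h. bilin (gradient F (u h)) (vector [q, - p, 0]))"
  define f2 where "f2 = (\<lambda>h. bilin (gradient F (u h)) (vector [p, q, 0]))"
  define u' :: "complex \<times> complex \<Rightarrow> complex^3"
    where "u' = (\<lambda>h. vector [fst h * q + snd h * p, - fst h * p + snd h * q, 0])"
  have u0: "u 0 = w" by (simp add: u_def w_def)
  have "((\<lambda>h. u h $ n) has_derivative (\<lambda>h. u' h $ n)) (at z)" for n z
    using exhaust_3[of n] by (auto simp: u_def u'_def intro!: derivative_eq_intros)
  then have der: "((\<lambda>h. eval3 G (u h)) has_derivative
      (\<lambda>h. bilin (gradient G (u z)) (u' h))) (at z)" for G z
    by (rule eval3_has_derivative)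
  have "(f has_derivative (\<lambda>h. f1 z * fst h + f2 z * snd h)) (at z)" for z
    unfolding f_def
    by (rule has_derivative_eq_rhs[OF der])
      (simp add: fun_eq_iff f1_def f2_def u'_def bilin_3 algebra_simps)
  moreover have "continuous_on UNIV (\<lambda>h. gradient F (u h) $ n)" for n
    unfolding gradient_def vec_lambda_beta
    by (intro continuous_at_imp_continuous_on ballI has_derivative_continuous[OF der])
  then have "continuous_on UNIV f1" "continuous_on UNIV f2"
    unfolding f1_def f2_def bilin_def
    by (intro continuous_on_sum continuous_on_mult continuous_on_const; simp)+
  moreover have "f 0 = 0" by (simp add: f_def u0 w)
  moreover have "f2 0 \<noteq> 0"
    using g by (simp add: f2_def u0 bilin_3 p_def q_def power2_eq_square)
  ultimately obtain s e where s: "e > 0" "s holomorphic_on ball 0 e" "s 0 = 0"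
      "\<And>t. t \<in> ball 0 e \<Longrightarrow> f (t, s t) = 0"
    by (rule holomorphic_implicit_function) (rule that)
  define x where "x = (\<lambda>t. a + t * q + s t * p)"
  define y where "y = (\<lambda>t. b - t * p + s t * q)"
  have ds: "(s has_field_derivative deriv s 0) (at 0)"
    using holomorphic_derivI[OF s(2) open_ball, of 0] s(1) by simp
  have "(x has_field_derivative q + deriv s 0 * p) (at 0)"
    "(y has_field_derivative - p + deriv s 0 * q) (at 0)"
    unfolding x_def y_def by (auto intro!: derivative_eq_intros ds)
  then have dxy: "deriv x 0 = q + deriv s 0 * p" "deriv y 0 = - p + deriv s 0 * q"
    by (auto dest: DERIV_imp_deriv)
  \<comment> \<open>Pairing the velocity with (q, -p) removes the unknown derivative of
    \<open>s\<close>.\<close>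
  have "deriv x 0 * q - deriv y 0 * p = p^2 + q^2"
    unfolding dxy by (simp add: algebra_simps power2_eq_square)
  then have "deriv x 0 \<noteq> 0 \<or> deriv y 0 \<noteq> 0"
    using g by (auto simp: p_def q_def)
  moreover have "x holomorphic_on ball 0 e" "y holomorphic_on ball 0 e"
    unfolding x_def y_def by (intro holomorphic_intros s(2))+
  moreover have "proj (vector [x t, y t, 1]) \<in> curve F" if "t \<in> ball 0 e" for t
    using s(4)[OF that]
    by (simp add: curve_proj_iff[OF F affine_point_nonzero] f_def u_def x_def y_def)
  moreover have xy0: "x 0 = a" "y 0 = b" by (simp_all add: x_def y_def s(3))
  ultimately have "regular_local_param F (proj w) x y"
    using s(1) unfolding regular_local_param_def w_def by blast
  with that xy0 show thesis by blast
qed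

subsection \<open>Irreducible curves of degree at least two are not cones\<close>

text \<open>Irreducibility makes \<open>L\<close> or its cofactor a unit: the first gives L dvd 1,
  the second F dvd L, and both contradict the comparison of degrees.\<close>

lemma homogeneous_linear_factor:
  assumes "irreducible F" "homogeneous d F" "d \<ge> 2" "homogeneous 1 L" "L \<noteq> 0"
  shows "\<not> L dvd F"
proof
  assume "L dvd F"
  then obtain A where A: "F = L * A" by (auto elim: dvdE)
  consider "L dvd 1" | "A dvd 1" using irreducibleD[OF assms(1) A] by blast
  then show False
  proof cases
    case 1
    have "homogeneous 0 1" using homogeneous_const[of 1] by (simp add: one_pCons)
    from homogeneous_dvd_degree_le[OF assms(4) this 1] show False by simp
  next
    case 2
    then obtain B where "1 = A * B" by (auto elim: dvdE)
    then have "L = F * B" by (simp add: A mult.assoc)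
    then have "F dvd L" by simp
    from homogeneous_dvd_degree_le[OF assms(2,4) this assms(5)] show False using assms(3) by simp
  qed
qed

lemma eval2_poly: "eval2 (poly G P) y z = eval3 G (vector [eval2 P y z, y, z])"
  by (induction G) (auto simp: eval3_pCons)

lemma eval2_eq_0_imp:
  assumes "\<And>y z. eval2 f y z = 0"
  shows "f = 0"
  using eval2_nonzero_point[of f] assms by blast

text \<open>The degree here is the one in x. A form in y and z alone has a linear factor over the
  complex numbers, either z or y - c z.\<close>

lemma homogeneous_irreducible_degree_pos:
  assumes F: "irreducible F" "homogeneous d F" "d \<ge> 2"
  shows "degree F > 0"
proof (rule ccontr)
  assume "\<not> degree F > 0"
  then obtain f where f: "F = [:f:]" by (auto elim: degree_eq_zeroE)
  show False
  proof (cases "degree f = 0")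
    case True
    then obtain p where p: "f = [:p:]" by (auto elim: degree_eq_zeroE)
    have "coeff (coeff (coeff F 0) 0) 0 = 0"
      using F(2,3) unfolding homogeneous_def by (metis add_0 not_numeral_le_zero)
    then have "[:0, 1:] dvd p"
      using poly_eq_0_iff_dvd[of p 0] by (simp add: f p poly_0_coeff_0)
    then have "[:[:[:0, 1:]:]:] dvd F" by (simp add: f p)
    moreover have "\<not> [:[:[:0, 1:]:]:] dvd F"
      by (rule homogeneous_linear_factor[OF F homogeneous_z]) simp
    ultimately show False by blast
  next
    case False
    \<comment> \<open>The factor \<open>[:0, 1:]\<close> is the variable z; it makes z nonzero, so
      that c = y / z is a genuine slope.\<close>
    then have "lead_coeff f * [:0, 1:] \<noteq> 0" by auto
    then obtain z where z: "poly (lead_coeff f * [:0, 1:]) z \<noteq> 0"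
      using poly_all_0_iff_0 by blast
    define q where "q = map_poly (\<lambda>p. poly p z) f"
    have q: "poly q y = eval2 f y z" for y
      unfolding q_def by (induction f) (auto simp: map_poly_pCons eval2_pCons)
    have "coeff q (degree f) \<noteq> 0" using z by (simp add: q_def coeff_map_poly)
    then have "degree q > 0" using le_degree[of q "degree f"] False by simp
    then obtain y where y: "eval2 f y z = 0"
      using fundamental_theorem_of_algebra[of q] by (auto simp: constant_degree q)
    have ev: "eval3 F v = eval2 f (v $ 2) (v $ 3)" for v by (simp add: f eval3_pCons)
    define c where "c = y / z"
    have "z \<noteq> 0" using z by auto
    have "poly (poly f [:0, c:]) t = 0" for t
    proof -
      have "poly (poly f [:0, c:]) t = eval2 f (t * c) t"
        unfolding eval2_def by (induction f) auto
      also have "\<dots> = eval3 F ((t / z) *s vector [0, y, z])"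
        using \<open>z \<noteq> 0\<close> by (simp add: ev c_def)
      also have "\<dots> = 0" by (simp only: eval3_scale[OF F(2)]) (simp add: ev y)
      finally show ?thesis .
    qed
    then have "poly f [:0, c:] = 0" using poly_all_0_iff_0 by blast
    then have "[:- [:0, c:], 1:] dvd f" by (simp only: poly_eq_0_iff_dvd)
    then have "[:[:- [:0, c:], 1:]:] dvd F" by (simp add: f)
    moreover have "homogeneous 1 [:[:- [:0, c:], 1:]:]"
      by (auto simp: homogeneous_def coeff_pCons one_pCons split: nat.splits if_splits)
    ultimately show False using homogeneous_linear_factor[OF F] by simp
  qed
qed

text \<open>If Delta_S F vanished identically, \<open>F\<close> would be invariant under translation
  by multiples of \<open>S\<close>. The curve would be a cone with vertex \<open>S\<close>, and a
  line through \<open>S\<close> would split off.\<close>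

lemma homogeneous_irreducible_Delta_nonzero:
  assumes F: "irreducible F" "homogeneous d F" "d \<ge> 2" and S: "S \<noteq> 0"
  obtains v where "Delta F S v \<noteq> 0"
proof (rule ccontr)
  assume "\<not> thesis"
  then have D0: "Delta F S v = 0" for v using that by blast
  have deg: "degree F > 0" by (rule homogeneous_irreducible_degree_pos[OF F])
  have transl: "eval3 F (v + t *s S) = eval3 F v" for v t
  proof -
    have "((\<lambda>t. eval3 F (v + t *s S)) has_field_derivative 0) (at t)" for t
      using eval3_line_has_field_derivative[of F v S t] D0[of "v + t *s S"]
      by (simp add: Delta_def bilin_def mult.commute)
    then obtain c where "\<forall>t\<in>UNIV. eval3 F (v + t *s S) = c"
      using has_field_derivative_zero_constant[of UNIV] by blast
    then show ?thesis by (metis UNIV_I vector_smult_lzero add_0_right)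
  qed
  show False
  proof (cases "S $ 2 = 0 \<and> S $ 3 = 0")
    case True
    then have "S $ 1 \<noteq> 0" using S by (auto simp: vec_eq_iff forall_3)
    then have "eval3 (pderiv F) v = 0" for v
      using D0[of v] True by (simp add: Delta_def bilin_3 gradient_def pdiff_def)
    then have "pderiv F = 0" using eval3_nonzero_point by blast
    then show False using deg by (simp add: pderiv_eq_0_iff)
  next
    case False
    \<comment> \<open>\<open>M\<close> is S_2 z - S_3 y. Where it is nonzero, a point above (y, z)
      and \<open>S\<close> span a plane that is a graph over the last two coordinates.\<close>
    define M where "M = [:[:0, S $ 2:], [:- S $ 3:]:]"
    have M: "eval2 M y z = S $ 2 * z - S $ 3 * y" for y z
      by (simp add: M_def eval2_def)
    have "M \<noteq> 0" using False by (auto simp: M_def)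
    then have "lead_coeff F * M \<noteq> 0" using deg by (metis degree_0 leading_coeff_0_iff less_irrefl
          no_zero_divisors)
    then obtain y z where "eval2 (lead_coeff F * M) y z \<noteq> 0" by (rule eval2_nonzero_point)
    then have lc: "eval2 (lead_coeff F) y z \<noteq> 0" and "eval2 M y z \<noteq> 0" by auto
    define \<delta> where "\<delta> = S $ 2 * z - S $ 3 * y"
    have \<delta>: "\<delta> \<noteq> 0" using \<open>eval2 M y z \<noteq> 0\<close> by (simp add: M \<delta>_def)
    obtain x where x: "eval3 F (vector [x, y, z]) = 0" by (rule eval3_root_over[OF deg lc])
    \<comment> \<open>By Cramer's rule, x = \<alpha> y + \<beta> z is the plane through the chosen
      zero of \<open>F\<close> and \<open>S\<close>; \<open>F\<close> vanishes on all of it.\<close>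
    define \<alpha> where "\<alpha> = (z * S $ 1 - x * S $ 3) / \<delta>"
    define \<beta> where "\<beta> = (x * S $ 2 - y * S $ 1) / \<delta>"
    define P where "P = [:[:0, \<beta>:], [:\<alpha>:]:]"
    have "eval2 (poly F P) Y Z = 0" for Y Z
    proof -
      define s where "s = (S $ 2 * Z - S $ 3 * Y) / \<delta>"
      define t where "t = (z * Y - y * Z) / \<delta>"
      have "vector [eval2 P Y Z, Y, Z] = s *s vector [x, y, z] + t *s S"
        using \<delta> by (simp add: vec_eq_iff forall_3 eval2_def P_def \<alpha>_def \<beta>_def s_def t_def
            divide_simps) (simp add: \<delta>_def algebra_simps)
      then show ?thesis
        unfolding eval2_poly by (simp add: transl eval3_scale[OF F(2)] x)
    qed
    then have "poly F P = 0" by (rule eval2_eq_0_imp)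
    then have "[:- P, 1:] dvd F" by (simp only: poly_eq_0_iff_dvd)
    moreover have "homogeneous 1 [:- P, 1:]"
      by (auto simp: homogeneous_def coeff_pCons one_pCons P_def split: nat.splits if_splits)
    ultimately show False using homogeneous_linear_factor[OF F] by simp
  qed
qed

section \<open>The exceptional locus, and contact points away from it\<close>

definition Delta_poly :: "poly3 \<Rightarrow> complex^3 \<Rightarrow> poly3" where
  "Delta_poly F S = [:[:[:S$1:]:]:] * pdiff 1 F + [:[:[:S$2:]:]:] * pdiff 2 F +
     [:[:[:S$3:]:]:] * pdiff 3 F"

lemma eval3_Delta_poly: "eval3 (Delta_poly F S) v = Delta F S v"
  by (simp only: Delta_poly_def eval3_add eval3_mult eval3_const Delta_def bilin_3 gradient_def
      vec_lambda_beta)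

lemma homogeneous_Delta_poly:
  "homogeneous d F \<Longrightarrow> homogeneous (d - 1) (Delta_poly F S)"
  unfolding Delta_poly_def
  by (intro homogeneous_add homogeneous_const_mult homogeneous_pdiff)

text \<open>A nonzero form of degree d - 1 cannot be a multiple of a form of degree d.\<close>

lemma not_dvd_Delta_poly:
  assumes F: "irreducible F" "homogeneous d F" "d \<ge> 2" and S: "S \<noteq> 0"
  shows "\<not> F dvd Delta_poly F S"
proof
  assume "F dvd Delta_poly F S"
  moreover have "Delta_poly F S \<noteq> 0"
    using homogeneous_irreducible_Delta_nonzero[OF F S] eval3_Delta_poly eval3_0 by metis
  ultimately have "d \<le> d - 1"
    by (intro homogeneous_dvd_degree_le[OF F(2) homogeneous_Delta_poly[OF F(2)]])
  with F(3) show False by simp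
qed

text \<open>The points of the curve outside this locus are not at infinity, their tangent line does not
  pass through \<open>S\<close> and is not isotropic: with \<open>I = (1, i, 0)\<close> and \<open>J = (1, -i, 0)\<close> one has
  \<open>\<Delta>\<^sub>I F \<Delta>\<^sub>J F = F\<^sub>x\<^sup>2 + F\<^sub>y\<^sup>2\<close>.\<close>

definition bad_locus_poly :: "poly3 \<Rightarrow> complex^3 \<Rightarrow> poly3" where
  "bad_locus_poly F S = [:[:[:0, 1:]:]:] * (Delta_poly F S *
     (Delta_poly F (vector [1, \<i>, 0]) * Delta_poly F (vector [1, -\<i>, 0])))"

lemma eval3_bad_locus_poly:
  "eval3 (bad_locus_poly F S) v =
     v$3 * (Delta F S v * ((gradient F v $ 1)^2 + (gradient F v $ 2)^2))"
proof -
  have "eval3 [:[:[:0, 1:]:]:] v = v$3" by (simp add: eval3_def)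
  moreover have "Delta F (vector [1, \<i>, 0]) v * Delta F (vector [1, -\<i>, 0]) v =
      (gradient F v $ 1)^2 + (gradient F v $ 2)^2"
    by (simp add: Delta_def bilin_3 algebra_simps power2_eq_square)
  ultimately show ?thesis
    by (simp only: bad_locus_poly_def eval3_mult eval3_Delta_poly)
qed

lemma homogeneous_bad_locus_poly:
  assumes "homogeneous d F"
  shows "homogeneous (1 + ((d - 1) + ((d - 1) + (d - 1)))) (bad_locus_poly F S)"
  unfolding bad_locus_poly_def
  by (intro homogeneous_mult homogeneous_z homogeneous_Delta_poly assms)

text \<open>\<open>F\<close> is prime, so the factors can be treated one by one: z has degree 1 < d,
  and the three polars fall under \<open>not_dvd_Delta_poly\<close>, two of them for the isotropic
  vectors (1, i, 0) and (1, -i, 0).\<close>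

lemma not_dvd_bad_locus_poly:
  assumes F: "irreducible F" "homogeneous d F" "d \<ge> 2" and S: "S \<noteq> 0"
  shows "\<not> F dvd bad_locus_poly F S"
proof -
  have "prime_elem F" using F(1) by (rule irreducible_imp_prime_poly)
  moreover have "\<not> F dvd [:[:[:0, 1:]:]:]"
    using homogeneous_dvd_degree_le[OF F(2) homogeneous_z] F(3) by auto
  moreover have "(vector [1, c, 0] :: complex^3) \<noteq> 0" for c
    by (simp add: vec_eq_iff forall_3)
  ultimately show ?thesis
    unfolding bad_locus_poly_def
    by (simp only: prime_elem_dvd_mult_iff not_dvd_Delta_poly[OF F] S simp_thms)
qed

text \<open>Pairing with the gradient kills the multiple of the identity, so the nonvanishing of
  \<open>Phi_tilde\<close> can be read off without any control of the Hessian.\<close>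

lemma bilin_gradient_Phi_tilde:
  assumes "bilin (gradient F v) v = 0"
  shows "bilin (gradient F v) (Phi_tilde d F S v) =
    - ((Delta F S v)^2 * ((gradient F v $ 1)^2 + (gradient F v $ 2)^2))"
proof -
  define g where "g = gradient F v"
  define W :: "complex^3" where "W = vector
      [(g$2)^2 * S$1 - (g$1)^2 * S$1 - 2 * g$1 * g$2 * S$2 - 2 * g$1 * g$3 * S$3,
       (g$1)^2 * S$2 - (g$2)^2 * S$2 - 2 * g$1 * g$2 * S$1 - 2 * g$2 * g$3 * S$3,
       S$3 * ((g$1)^2 + (g$2)^2)]"
  define k where "k = - (2 * hessian F v * N_poly S v / (of_nat d - 1)^2)"
  have W: "bilin g W = - (Delta F S v * ((g$1)^2 + (g$2)^2))"
    by (simp add: W_def bilin_3 Delta_def flip: g_def) (simp add: algebra_simps power2_eq_square)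
  have "bilin g (Phi_tilde d F S v) = k * bilin g v + Delta F S v * bilin g W"
    unfolding Phi_tilde_def Let_def k_def[symmetric] g_def[symmetric] W_def[symmetric]
    by (simp add: bilin_3 algebra_simps)
  with assms W show ?thesis by (simp add: g_def[symmetric] power2_eq_square)
qed

text \<open>A converse to \<open>contact_point_eq_Phi\<close>. Off the exceptional locus the point
  can be scaled to z = 1, a local parametrization exists there, and the scalar in
  \<open>contact_cprod\<close> is nonzero.\<close>

lemma contact_point_Phi:
  assumes F: "homogeneous d F" "d \<ge> 2"
    and v: "v \<noteq> 0" "eval3 F v = 0" "eval3 (bad_locus_poly F S) v \<noteq> 0"
  shows "proj v \<in> admissible_points F S" "Phi_defined d F S (proj v)"
    "contact_point F S (proj v) (Phi d F S (proj v))"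
proof -
  have v3: "v$3 \<noteq> 0" using v(3) by (auto simp: eval3_bad_locus_poly)
  define a where "a = v$1 / v$3"
  define b where "b = v$2 / v$3"
  define w :: "complex^3" where "w = vector [a, b, 1]"
  have vw: "v = v$3 *s w"
    using v3 by (simp add: vec_eq_iff forall_3 w_def a_def b_def)
  have w0: "w \<noteq> 0" by (simp add: w_def affine_point_nonzero)
  have pw: "proj v = proj w" using vw by (metis proj_eq_iff[OF w0 v(1)])
  have Fw: "eval3 F w = 0"
    using v(2) v3 eval3_scale[OF F(1), of "v$3" w] vw by auto
  have "eval3 (bad_locus_poly F S) w \<noteq> 0"
    using v(3) eval3_scale[OF homogeneous_bad_locus_poly[OF F(1)], of S "v$3" w] vw by auto
  then have D: "Delta F S w \<noteq> 0" and g: "(gradient F w $ 1)^2 + (gradient F w $ 2)^2 \<noteq> 0"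
    by (auto simp: eval3_bad_locus_poly)
  have eul: "bilin w (gradient F w) = 0" by (simp add: homogeneous_euler[OF F(1)] Fw)
  have grad: "gradient F w \<noteq> 0" using g by auto
  have "proj w \<in> Reg F"
    unfolding Reg_def using w0 grad Fw curve_proj_iff[OF F(1) w0] by blast
  \<comment> \<open>At a point of the curve proportional to \<open>S\<close>, Euler's relation would
    give Delta_S F = 0.\<close>
  moreover have "proj w \<noteq> proj S"
  proof
    assume eq: "proj w = proj S"
    have "S \<noteq> 0" using D by (auto simp: Delta_def bilin_3)
    with eq obtain c where "S = c *s w" using proj_eq_iff[OF w0] by blast
    then have "Delta F S w = c * bilin w (gradient F w)"
      by (simp add: Delta_def bilin_3 algebra_simps)
    with D eul show False by simp
  qed
  moreover have "proj w \<notin> line_at_infinity"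
    unfolding line_at_infinity_def proj_in_proj_line_iff[OF w0] by (simp add: bilin_3 w_def)
  ultimately show "proj v \<in> admissible_points F S"
    by (simp add: admissible_points_def pw)
  have "bilin (gradient F w) w = 0" using eul by (simp add: bilin_3 mult.commute)
  then have "bilin (gradient F w) (Phi_tilde d F S w) \<noteq> 0"
    using D g by (simp add: bilin_gradient_Phi_tilde)
  then have Phi: "Phi_tilde d F S w \<noteq> 0" by (auto simp: bilin_3)
  then show "Phi_defined d F S (proj v)" by (simp add: pw Phi_defined_proj[OF F w0])
  obtain x y where par: "regular_local_param F (proj w) x y" "x 0 = a" "y 0 = b"
    using regular_local_param_exists[OF F(1), of a b] Fw g unfolding w_def by blast
  have wxy: "w = vector [x 0, y 0, 1]" by (simp add: w_def par)
  obtain \<tau> where \<tau>: "\<tau> \<noteq> 0" "cprod (rho_tilde F S (vector [x 0, y 0, 1]))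
      (\<chi> n. deriv (\<lambda>t. rho_tilde F S (vector [x t, y t, 1]) $ n) 0) =
      (- (\<tau> * ((gradient F w $ 1)^2 + (gradient F w $ 2)^2))) *s Phi_tilde d F S w"
    (is "cprod ?r ?r' = ?k *s _")
    using contact_cprod[OF F par(1)] grad unfolding wxy by blast
  have k: "?k \<noteq> 0" using \<tau>(1) g by simp
  have ind: "lin_indep2 ?r ?r'"
    unfolding lin_indep2_iff_cprod \<tau>(2) using k Phi by simp
  have "bilin ?r (Phi_tilde d F S w) = 0" "bilin ?r' (Phi_tilde d F S w) = 0"
    using bilin_cprod(1)[of ?r ?r'] bilin_cprod(2)[of ?r' ?r] k unfolding \<tau>(2) bilin_smult_right by auto
  then have "proj (Phi_tilde d F S w) \<in> proj_line ?r" "proj (Phi_tilde d F S w) \<in> proj_line ?r'"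
    by (simp_all add: proj_in_proj_line_iff Phi)
  then show "contact_point F S (proj v) (Phi d F S (proj v))"
    unfolding contact_point_def Let_def pw Phi_proj[OF F w0 Phi] reflected_line_def
    using par(1) ind by blast
qed

section \<open>Equality of the Zariski closures, and contact points at generic points of the
  curve\<close>

theorem theorem1:
  fixes F :: "complex poly poly poly" and d :: nat and S :: "complex^3"
  assumes "irreducible F" and "homogeneous d F" and "d \<ge> 2" and "S \<noteq> 0"
  shows "caustic F S = zariski_closure (Phi_image d F S (curve F)) \<and>
         for_generic (curve F) (\<lambda>m. m \<in> admissible_points F S \<and>
           Phi_defined d F S m \<and> contact_point F S m (Phi d F S m))"
proof
  note F = assms(1-3) and hF = assms(2,3)
  define K where "K = bad_locus_poly F S"
  have deg: "degree F > 0" by (rule homogeneous_irreducible_degree_pos[OF F])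
  have prime: "prime_elem F" using F(1) by (rule irreducible_imp_prime_poly)
  have K: "\<not> F dvd K" unfolding K_def by (rule not_dvd_bad_locus_poly[OF F assms(4)])
  have hK: "\<exists>n. homogeneous n K" unfolding K_def using homogeneous_bad_locus_poly[OF F(2)] by blast
  have good: "v \<noteq> 0 \<Longrightarrow> eval3 F v = 0 \<Longrightarrow> eval3 K v \<noteq> 0 \<Longrightarrow>
      proj v \<in> admissible_points F S \<and> Phi_defined d F S (proj v) \<and>
      contact_point F S (proj v) (Phi d F S (proj v))" for v
    unfolding K_def using contact_point_Phi[OF hF] by blast
  show "for_generic (curve F) (\<lambda>m. m \<in> admissible_points F S \<and>
           Phi_defined d F S m \<and> contact_point F S m (Phi d F S m))"
    unfolding for_generic_def
  proof (intro exI[of _ "zero_locus {K}"] conjI ballI)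
    show "zariski_closed (zero_locus {K})"
      unfolding zariski_closed_def using hK by (intro exI[of _ "{K}"]) auto
    show "\<not> curve F \<subseteq> zero_locus {K}"
    proof
      assume sub: "curve F \<subseteq> zero_locus {K}"
      have "F dvd K"
      proof (rule dvd_if_vanishes_on_zeros[OF F(1) deg])
        fix v :: "complex^3" assume "v \<noteq> 0" "eval3 F v = 0"
        then have "proj v \<in> zero_locus {K}" using sub curve_proj_iff[OF F(2)] by blast
        with \<open>v \<noteq> 0\<close> show "eval3 K v = 0" by (auto simp: zero_locus_def)
      qed
      with K show False by blast
    qed
    fix m assume m: "m \<in> curve F - zero_locus {K}"
    then obtain v where v: "v \<noteq> 0" "m = proj v" "eval3 K v \<noteq> 0"
      by (auto simp: zero_locus_def)
    then have "eval3 F v = 0" using m curve_proj_iff[OF F(2)] by blast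
    from good[OF v(1) this v(3)]
    show "m \<in> admissible_points F S" "Phi_defined d F S m" "contact_point F S m (Phi d F S m)"
      by (simp_all add: v(2))
  qed
  have env_sub: "envelope F S \<subseteq> Phi_image d F S (curve F)"
    using contact_point_eq_Phi[OF hF] unfolding envelope_def Phi_image_def by blast
  \<comment> \<open>The image may contain more points than the envelope, but each closed set
    containing the envelope has to absorb them.\<close>
  have "Phi_image d F S (curve F) \<subseteq> Z" if Z: "zariski_closed Z" "envelope F S \<subseteq> Z" for Z
  proof
    fix p assume "p \<in> Phi_image d F S (curve F)"
    then obtain m where m: "m \<in> curve F" "Phi_defined d F S m" "p = Phi d F S m"
      by (auto simp: Phi_image_def)
    define v where "v = rep_cp2 m"
    have v: "v \<noteq> 0" "m = proj v" by (simp_all add: v_def rep_cp2_nonzero proj_rep_cp2)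
    have Fv: "eval3 F v = 0" using m(1) v curve_proj_iff[OF F(2)] by blast
    have Phi: "Phi_tilde d F S v \<noteq> 0" and p: "p = proj (Phi_tilde d F S v)"
      using m(2,3) by (simp_all add: Phi_defined_def Phi_def v_def)
    obtain T where T: "\<And>G. G \<in> T \<Longrightarrow> \<exists>n. homogeneous n G" "Z = zero_locus T"
      using Z(1) by (auto simp: zariski_closed_def)
    have "eval3 G u = 0" if G: "G \<in> T" and u: "u \<noteq> 0" "proj u = p" for G u
    proof -
      obtain n where n: "homogeneous n G" using T(1)[OF G] by blast
      obtain Q where Q: "\<And>w. eval3 G (Phi_tilde d F S w) = eval3 Q w"
        using poly_fun3_compose[OF n poly_fun3_Phi_tilde] unfolding poly_fun3_def by blast
      \<comment> \<open>At a zero of \<open>F\<close>, either \<open>K\<close> vanishes, or the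
        image under \<open>Phi\<close> lies on the envelope and \<open>G\<close> vanishes at
        it.\<close>
      have "F dvd Q * K"
      proof (rule dvd_if_vanishes_on_zeros[OF F(1) deg])
        fix w :: "complex^3" assume w: "w \<noteq> 0" "eval3 F w = 0"
        have "eval3 Q w = 0" if Kw: "eval3 K w \<noteq> 0"
        proof -
          note gw = good[OF w Kw]
          then have nz: "Phi_tilde d F S w \<noteq> 0" using Phi_defined_proj[OF hF w(1)] by blast
          have "Phi d F S (proj w) \<in> envelope F S" using gw by (auto simp: envelope_def)
          then have "proj (Phi_tilde d F S w) \<in> zero_locus T"
            using Z(2) T(2) Phi_proj[OF hF w(1) nz] by auto
          then show ?thesis using G nz Q[of w] by (auto simp: zero_locus_def)
        qed
        then show "eval3 (Q * K) w = 0" by auto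
      qed
      then have "F dvd Q" using prime_elem_dvd_multD[OF prime] K by blast
      then have "eval3 Q v = 0" using Fv by (auto elim!: dvdE)
      then have GPhi: "eval3 G (Phi_tilde d F S v) = 0" by (simp add: Q)
      obtain c where "u = c *s Phi_tilde d F S v"
        using u p proj_eq_iff[OF Phi u(1)] by auto
      then show ?thesis by (simp add: eval3_scale[OF n] GPhi)
    qed
    then show "p \<in> Z" unfolding T(2) zero_locus_def by blast
  qed
  \<comment> \<open>Both sets have the same closed supersets, hence the same hull.\<close>
  with env_sub have "zariski_closed Z \<and> envelope F S \<subseteq> Z \<longleftrightarrow>
      zariski_closed Z \<and> Phi_image d F S (curve F) \<subseteq> Z" for Z
    by blast
  then show "caustic F S = zariski_closure (Phi_image d F S (curve F))"
    by (simp add: caustic_def zariski_closure_def hull_def)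
qed

end
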